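(* Let $X$ be a real-valued standard Markov process with positive jumps (i.e. $\Delta X_t\ge 0$ for all $t$), let $\alpha>0$, let $G_\alpha$ be its $\alpha$-Green kernel, and let $g\colon\mathbb{R}\to[0,\infty)$ be a continuous function. Suppose that there exist two Borel functions $f,\tilde g\colon\mathbb{R}\to\mathbb{R}$ and a point $x^*\in\mathbb{R}$ such that (i) $\tilde g(x)=\int_{-\infty}^{\infty}f(y)\,G_\alpha(x,dy)$ for all $x\in\mathbb{R}$ (the integrals being absolutely convergent); (ii) $\tilde g(x^* )=\int_{x^*}^{\infty}f(y)\,G_\alpha(x^*,dy)$; (iii) $f(x)\ge 0$ for all $x\ge x^*$; (iv) $\int_{x^*}^{\infty}f(y)\,G_\alpha(x,dy)\ge g(x)$ for all $x\le x^*$; (v) $g(x)=\tilde g(x)$ for all $x\ge x^*$. Set $$\tau^*=\inf\{t\ge 0\colon X_t\ge x^*\},\qquad V_\alpha(x)=\int_{x^*}^{\infty}f(y)\,G_\alpha(x,dy)\quad(x\in\mathbb{R}).$$ Then $\tau^*$ is an optimal stopping time and $V_\alpha$ is the value function of the optimal stopping problem with reward $g$ and discount $\alpha$; that is, for every $x\in\mathbb{R}$, $$V_\alpha(x)=\sup_{\tau}\mathbb{E}_x\left(e^{-\alpha\tau}g(X_\tau)\right)=\mathbb{E}_x\left(e^{-\alpha\tau^*}g(X_{\tau^*})\right),$$ where the supremum is over all stopping times $\tau$ with respect to the filtration $\{\mathcal{F}_t\}$.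
   Context: A standard Markov process is a real-valued, time-homogeneous, non-terminating (infinite lifetime) strong Markov process $X=(\{X_t\}_{t\ge0},\{\mathcal{F}_t\}_{t\ge 0},\{\mathbb{P}_x\}_{x\in\mathbb{R}})$ on a space $(\Omega,\mathcal{F})$, with $X_0=x$ under $\mathbb{P}_x$ and state space $\mathbb{R}$, which is adapted (progressively measurable), has càdlàg paths, and is left-quasi-continuous: for every stopping time $\tau$, $X_\tau$ is $\mathcal{F}_\tau$-measurable, and for every non-decreasing sequence of stopping times $\tau_n\to\tau$ one has $X_{\tau_n}\to X_\tau$ $\mathbb{P}_x$-a.s. on $\{\tau<\infty\}$, for all $x\in\mathbb{R}$. The filtration $\{\mathcal{F}_t\}$ is right-continuous and each $\mathcal{F}_t$ is $\mathbb{P}_x$-complete for all $x$. $\mathbb{E}_x$ is expectation under $\mathbb{P}_x$. A stopping time is a random variable $\tau$ with values in $[0,\infty]$ such that $\{\tau<t\}\in\mathcal{F}_t$ for all $t\ge 0$. The jump at time $t$ is $\Delta X_t=X_t-\lim_{s\to t^-}X_s$. The $\alpha$-Green kernel is $G_\alpha(x,H)=\int_0^\infty e^{-\alpha t}\,\mathbb{P}_x(X_t\in H)\,dt$ for $x\in\mathbb{R}$ and $H\subseteq\mathbb{R}$ Borel. Conventions: $\int_{x^*}^\infty$ denotes integration over $[x^*,\infty)$, and $e^{-\alpha\tau}g(X_\tau)=0$ on $\{\tau=\infty\}$. *)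

theory Defs
  imports "HOL-Probability.Probability"
begin

text \<open>
  Time is real-valued and only its values \<open>t \<ge> 0\<close> matter. \<open>M\<close> stands for the measurable
  space \<open>(\<Omega>, \<F>)\<close>: only \<open>space M\<close> and \<open>sets M\<close> are used. Likewise a filtration is a
  family of measures of which only the sigma-algebras matter. Random times take values in
  \<open>[0, \<infinity>]\<close>, which is the type \<^typ>\<open>ennreal\<close>.
\<close>

definition is_stopping_time :: "'a measure \<Rightarrow> (real \<Rightarrow> 'a measure) \<Rightarrow> ('a \<Rightarrow> ennreal) \<Rightarrow> bool" where
  "is_stopping_time M F \<tau> \<longleftrightarrow>
     \<tau> \<in> borel_measurable M \<and> (\<forall>t\<ge>0. {\<omega> \<in> space M. \<tau> \<omega> < ennreal t} \<in> sets (F t))"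

text \<open>
  The sigma-algebra \<open>\<F>\<^sub>\<tau>\<close>. For a right-continuous filtration the generating family below is
  itself a sigma-algebra, and \<open>\<tau> \<le> t\<close> could equivalently be replaced by \<open>\<tau> < t\<close>.
\<close>

definition sigma_at :: "'a measure \<Rightarrow> (real \<Rightarrow> 'a measure) \<Rightarrow> ('a \<Rightarrow> ennreal) \<Rightarrow> 'a measure" where
  "sigma_at M F \<tau> =
     sigma (space M) {A \<in> sets M. \<forall>t\<ge>0. {\<omega> \<in> A. \<tau> \<omega> \<le> ennreal t} \<in> sets (F t)}"

text \<open>
  \<open>X\<^sub>\<tau>\<close>. On \<open>\<tau> = \<infinity>\<close> the value is meaningless (\<^const>\<open>enn2real\<close> sends \<open>\<infinity>\<close> to \<open>0\<close>), so this is
  only ever used where \<open>\<tau> < \<infinity>\<close>.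
\<close>

definition at_time :: "(real \<Rightarrow> 'a \<Rightarrow> real) \<Rightarrow> ('a \<Rightarrow> ennreal) \<Rightarrow> 'a \<Rightarrow> real" where
  "at_time X \<tau> \<omega> = X (enn2real (\<tau> \<omega>)) \<omega>"

text \<open>
  Completeness of the filtration is understood as usual for a family of laws: \<open>\<F>\<^sub>t\<close> contains
  every set that belongs to the \<open>P\<^sub>x\<close>-completion of \<open>\<F>\<^sub>t\<close> for all \<open>x\<close> simultaneously.
  Requiring instead, for each single \<open>x\<close>, that every subset of a \<open>P\<^sub>x\<close>-null set lie in \<open>\<F>\<^sub>t\<close> would
  make every subset of \<open>\<Omega>\<close> a member of \<open>\<F>\<^sub>0\<close>, because \<open>{X\<^sub>0 \<noteq> x}\<close> is \<open>P\<^sub>x\<close>-null for each \<open>x\<close>.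

  The Markov property at the constant times, and time-homogeneity, are instances of
  \<open>strong_markov\<close>, which says
  \<open>P\<^sub>x(\<tau> < \<infinity>, X\<^sub>\<tau>\<^sub>+\<^sub>s \<in> H | \<F>\<^sub>\<tau>) = P\<^bsub>X\<^sub>\<tau>\<^esub>(X\<^sub>s \<in> H)\<close> a.s. on \<open>\<tau> < \<infinity>\<close>.
\<close>

locale standard_markov_process =
  fixes M :: "'a measure"
    and F :: "real \<Rightarrow> 'a measure"
    and P :: "real \<Rightarrow> 'a measure"
    and X :: "real \<Rightarrow> 'a \<Rightarrow> real"
  assumes prob_space_P: "\<And>x. prob_space (P x)"
    and sets_P: "\<And>x. sets (P x) = sets M"
    and subalgebra_F: "\<And>t. 0 \<le> t \<Longrightarrow> subalgebra M (F t)"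
    and mono_F: "\<And>s t. 0 \<le> s \<Longrightarrow> s \<le> t \<Longrightarrow> sets (F s) \<subseteq> sets (F t)"
    and right_continuous_F: "\<And>t. 0 \<le> t \<Longrightarrow> sets (F t) = (\<Inter>s\<in>{t<..}. sets (F s))"
    and complete_F:
      "\<And>t. 0 \<le> t \<Longrightarrow> (\<Inter>x. sets (completion (restr_to_subalg (P x) (F t)))) \<subseteq> sets (F t)"
    and start: "\<And>x. AE \<omega> in P x. X 0 \<omega> = x"
    and kernel_measurable:
      "\<And>t H. 0 \<le> t \<Longrightarrow> H \<in> sets borel \<Longrightarrow>
         (\<lambda>x. measure (P x) {\<omega> \<in> space M. X t \<omega> \<in> H}) \<in> borel_measurable borel"
    and progressive:
      "\<And>t. 0 \<le> t \<Longrightarrow>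
         (\<lambda>(s, \<omega>). X s \<omega>) \<in> borel_measurable (restrict_space borel {0..t} \<Otimes>\<^sub>M F t)"
    and right_continuous_paths:
      "\<And>\<omega> t. \<omega> \<in> space M \<Longrightarrow> 0 \<le> t \<Longrightarrow> ((\<lambda>s. X s \<omega>) \<longlongrightarrow> X t \<omega>) (at_right t)"
    and left_limits:
      "\<And>\<omega> t. \<omega> \<in> space M \<Longrightarrow> 0 < t \<Longrightarrow> \<exists>l. ((\<lambda>s. X s \<omega>) \<longlongrightarrow> l) (at_left t)"
    and strong_markov:
      "\<And>x \<tau> s H. is_stopping_time M F \<tau> \<Longrightarrow> 0 \<le> s \<Longrightarrow> H \<in> sets borel \<Longrightarrow>
         AE \<omega> in P x. \<tau> \<omega> < \<infinity> \<longrightarrow>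
           real_cond_exp (P x) (sigma_at M F \<tau>)
             (indicator {\<omega>' \<in> space M. \<tau> \<omega>' < \<infinity> \<and> X (enn2real (\<tau> \<omega>') + s) \<omega>' \<in> H}) \<omega>
           = measure (P (at_time X \<tau> \<omega>)) {\<omega>' \<in> space M. X s \<omega>' \<in> H}"
    and at_time_measurable:
      "\<And>\<tau>. is_stopping_time M F \<tau> \<Longrightarrow>
         at_time X \<tau> \<in> borel_measurable
           (restrict_space (sigma_at M F \<tau>) {\<omega> \<in> space M. \<tau> \<omega> < \<infinity>})"
    and left_quasi_continuous:
      "\<And>x T \<tau>. (\<And>n. is_stopping_time M F (T n)) \<Longrightarrow>
         (\<And>\<omega>. \<omega> \<in> space M \<Longrightarrow> incseq (\<lambda>n. T n \<omega>)) \<Longrightarrow>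
         (\<And>\<omega>. \<omega> \<in> space M \<Longrightarrow> (\<lambda>n. T n \<omega>) \<longlonglongrightarrow> \<tau> \<omega>) \<Longrightarrow>
         AE \<omega> in P x. \<tau> \<omega> < \<infinity> \<longrightarrow> (\<lambda>n. at_time X (T n) \<omega>) \<longlonglongrightarrow> at_time X \<tau> \<omega>"

definition jump :: "(real \<Rightarrow> 'a \<Rightarrow> real) \<Rightarrow> real \<Rightarrow> 'a \<Rightarrow> real" where
  "jump X t \<omega> = X t \<omega> - Lim (at_left t) (\<lambda>s. X s \<omega>)"

text \<open>There is no left limit at time \<open>0\<close>, hence no jump.\<close>

definition positive_jumps :: "'a measure \<Rightarrow> (real \<Rightarrow> 'a \<Rightarrow> real) \<Rightarrow> bool" where
  "positive_jumps M X \<longleftrightarrow> (\<forall>\<omega>\<in>space M. \<forall>t>0. 0 \<le> jump X t \<omega>)"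

definition green_kernel ::
  "(real \<Rightarrow> 'a measure) \<Rightarrow> (real \<Rightarrow> 'a \<Rightarrow> real) \<Rightarrow> real \<Rightarrow> real \<Rightarrow> real measure" where
  "green_kernel P X \<alpha> x = measure_of UNIV (sets borel)
     (\<lambda>H. \<integral>\<^sup>+ t \<in> {0..}. ennreal (exp (- \<alpha> * t)) *
            emeasure (P x) {\<omega> \<in> space (P x). X t \<omega> \<in> H} \<partial>lborel)"

text \<open>
  \<^const>\<open>measure_of\<close> yields the null measure when the given set function is not a measure; the
  last lemma of the following context shows that this does not happen here.
\<close>

context standard_markov_process
begin

lemma space_P: "space (P x) = space M"
  using sets_P by (rule sets_eq_imp_space_eq)

lemma X_jointly_measurable:
  assumes "0 \<le> t"
  shows "(\<lambda>(s, \<omega>). X s \<omega>) \<in> borel_measurable (restrict_space borel {0..t} \<Otimes>\<^sub>M P x)"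
proof -
  have "(\<lambda>\<omega>. \<omega>) \<in> measurable (P x) (F t)"
    using subalgebra_F[OF assms] sets_P[of x] space_P[of x]
    by (intro measurableI) (auto simp: subalgebra_def sets.Int_space_eq2)
  then have "(\<lambda>z. (fst z, snd z)) \<in>
      measurable (restrict_space borel {0..t} \<Otimes>\<^sub>M P x) (restrict_space borel {0..t} \<Otimes>\<^sub>M F t)"
    by (intro measurable_Pair measurable_compose[OF measurable_snd]) auto
  from measurable_compose[OF this progressive[OF assms]] show ?thesis
    by (simp add: case_prod_beta')
qed

lemma X_measurable: "0 \<le> t \<Longrightarrow> X t \<in> borel_measurable (P x)"
  using measurable_compose[OF measurable_Pair1' X_jointly_measurable[of t x], of t]
  by (simp add: space_restrict_space)

lemma law_measurable:
  assumes "H \<in> sets borel"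
  shows "(\<lambda>t. emeasure (P x) {\<omega> \<in> space (P x). X t \<omega> \<in> H} * indicator {0..} t)
           \<in> borel_measurable lborel"
proof -
  let ?p = "\<lambda>t. emeasure (P x) {\<omega> \<in> space (P x). X t \<omega> \<in> H}"
  interpret prob_space "P x" by (rule prob_space_P)
  have *: "(\<lambda>t. ?p t * indicator {0..real n} t) \<in> borel_measurable lborel" for n :: nat
  proof -
    let ?B = "restrict_space borel {0..real n} :: real measure"
    have "{z \<in> space (?B \<Otimes>\<^sub>M P x). (case z of (s, \<omega>) \<Rightarrow> X s \<omega>) \<in> H} \<in> sets (?B \<Otimes>\<^sub>M P x)"
      using assms X_jointly_measurable[of "real n" x] by (auto intro: measurable_sets_Collect)
    from measurable_emeasure_Pair[OF this]
    have "?p \<in> borel_measurable ?B"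
      by (rule measurable_cong[THEN iffD1, rotated])
         (auto simp: space_pair_measure space_restrict_space intro!: arg_cong[where f="emeasure _"])
    then show ?thesis
      by (simp add: borel_measurable_restrict_space_iff_ennreal)
  qed
  have "(\<lambda>t. ?p t * indicator {0..} t) = (\<lambda>t. SUP n. ?p t * indicator {0..real n} t)"
  proof
    fix t :: real
    obtain m where m: "t \<le> real m" using real_arch_simple by blast
    show "?p t * indicator {0..} t = (SUP n. ?p t * indicator {0..real n} t)"
      using m by (intro antisym SUP_upper2[of m] SUP_least) (auto split: split_indicator)
  qed
  with * show ?thesis by simp
qed

lemma space_green_kernel [simp]: "space (green_kernel P X \<alpha> x) = UNIV"
  and sets_green_kernel [simp, measurable_cong]: "sets (green_kernel P X \<alpha> x) = sets borel"
  unfolding green_kernel_def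
  using sets.sigma_sets_eq[of "borel :: real measure"]
  by (simp_all add: space_measure_of_conv sets_measure_of_conv)

lemma emeasure_green_kernel:
  assumes "H \<in> sets borel"
  shows "emeasure (green_kernel P X \<alpha> x) H =
    (\<integral>\<^sup>+ t \<in> {0..}. ennreal (exp (- \<alpha> * t)) *
       emeasure (P x) {\<omega> \<in> space (P x). X t \<omega> \<in> H} \<partial>lborel)"
proof (rule emeasure_measure_of[OF green_kernel_def])
  let ?p = "\<lambda>H t. emeasure (P x) {\<omega> \<in> space (P x). X t \<omega> \<in> H}"
  let ?\<mu> = "\<lambda>H. \<integral>\<^sup>+ t \<in> {0..}. ennreal (exp (- \<alpha> * t)) * ?p H t \<partial>lborel"
  show "countably_additive (sets (green_kernel P X \<alpha> x)) ?\<mu>"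
  proof (rule countably_additiveI)
    fix A :: "nat \<Rightarrow> real set"
    assume "range A \<subseteq> sets (green_kernel P X \<alpha> x)" and disj: "disjoint_family A"
    then have A: "A i \<in> sets borel" for i by auto
    have "(\<Sum>i. ?\<mu> (A i)) =
        (\<integral>\<^sup>+ t. (\<Sum>i. ennreal (exp (- \<alpha> * t)) * ?p (A i) t * indicator {0..} t) \<partial>lborel)"
    proof (rule nn_integral_suminf[symmetric])
      fix i
      show "(\<lambda>t. ennreal (exp (- \<alpha> * t)) * ?p (A i) t * indicator {0..} t)
          \<in> borel_measurable lborel"
        using law_measurable[OF A, of x i] unfolding mult.assoc by measurable
    qed
    also have "\<dots> = ?\<mu> (\<Union>i. A i)"
    proof (rule nn_integral_cong)
      fix t :: real
      show "(\<Sum>i. ennreal (exp (- \<alpha> * t)) * ?p (A i) t * indicator {0..} t) =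
          ennreal (exp (- \<alpha> * t)) * ?p (\<Union>i. A i) t * indicator {0..} t"
      proof (cases "0 \<le> t")
        case True
        have "{\<omega> \<in> space (P x). X t \<omega> \<in> A i} \<in> sets (P x)" for i
          using measurable_sets[OF X_measurable[OF True] A[of i]]
          by (simp add: vimage_def Int_def conj_commute)
        then have "(\<Sum>i. ?p (A i) t) = emeasure (P x) (\<Union>i. {\<omega> \<in> space (P x). X t \<omega> \<in> A i})"
          using disj by (intro suminf_emeasure) (blast, fastforce simp: disjoint_family_on_def)
        moreover have "(\<Union>i. {\<omega> \<in> space (P x). X t \<omega> \<in> A i}) =
            {\<omega> \<in> space (P x). X t \<omega> \<in> (\<Union>i. A i)}"
          by blast
        ultimately have "(\<Sum>i. ?p (A i) t) = ?p (\<Union>i. A i) t"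
          by (simp only:)
        then show ?thesis
          using True by (simp only: ennreal_suminf_cmult ennreal_suminf_multc)
      qed simp
    qed
    finally show "(\<Sum>i. ?\<mu> (A i)) = ?\<mu> (\<Union>i. A i)" .
  qed
qed (use assms in \<open>auto simp: positive_def\<close>)

end

text \<open>Here \<^const>\<open>Inf\<close> is taken in \<^typ>\<open>ennreal\<close>, so the infimum of the empty set is \<open>\<infinity>\<close>.\<close>

definition entrance_time :: "(real \<Rightarrow> 'a \<Rightarrow> real) \<Rightarrow> real \<Rightarrow> 'a \<Rightarrow> ennreal" where
  "entrance_time X b \<omega> = Inf {ennreal t | t. 0 \<le> t \<and> b \<le> X t \<omega>}"

definition discounted_reward ::
  "(real \<Rightarrow> 'a \<Rightarrow> real) \<Rightarrow> real \<Rightarrow> (real \<Rightarrow> real) \<Rightarrow> ('a \<Rightarrow> ennreal) \<Rightarrow> 'a \<Rightarrow> real" where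
  "discounted_reward X \<alpha> g \<tau> \<omega> =
     (if \<tau> \<omega> = \<infinity> then 0 else exp (- \<alpha> * enn2real (\<tau> \<omega>)) * g (at_time X \<tau> \<omega>))"

text \<open>
  For a nonnegative reward \<open>g\<close> the expectation is a value in \<open>[0, \<infinity>]\<close>. It is embedded in
  \<^typ>\<open>ereal\<close> so that a real candidate value can be compared with it without truncation.
\<close>

definition expected_reward ::
  "(real \<Rightarrow> 'a measure) \<Rightarrow> (real \<Rightarrow> 'a \<Rightarrow> real) \<Rightarrow> real \<Rightarrow> (real \<Rightarrow> real) \<Rightarrow> real \<Rightarrow>
    ('a \<Rightarrow> ennreal) \<Rightarrow> ereal" where
  "expected_reward P X \<alpha> g x \<tau> =
     enn2ereal (\<integral>\<^sup>+ \<omega>. ennreal (discounted_reward X \<alpha> g \<tau> \<omega>) \<partial>P x)"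

end

theory Submission
  imports Defs
begin

text \<open>
  Put \<open>h = f 1\<^bsub>[x\<^sup>*, \<infinity>)\<^esub>\<close>, a nonnegative function whose Green potential is \<open>V\<close>. The strong Markov
  property at a stopping time \<open>\<tau>\<close>, together with Tonelli's theorem, gives
  \<open>E\<^sub>x (e\<^bsup>-\<alpha>\<tau>\<^esup> V(X\<^sub>\<tau>)) = E\<^sub>x \<integral>\<^bsub>\<tau>\<^esub> e\<^bsup>-\<alpha>t\<^esup> h(X\<^sub>t) dt\<close>, the integral being over \<open>[\<tau>, \<infinity>)\<close>
  (\<open>discounted_green_kernel_at_stopping_time\<close>). So the left side is at most \<open>V(x)\<close>, with equality
  if \<open>h(X\<^sub>t) = 0\<close> for \<open>t < \<tau>\<close> (\<open>green_kernel_excessive\<close>, \<open>green_kernel_harmonic_before\<close>).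
  The latter is the case for the entrance time into \<open>[x\<^sup>*, \<infinity>)\<close>. The theorem therefore follows once
  \<open>g \<le> V\<close> everywhere and \<open>g = V\<close> on \<open>[x\<^sup>*, \<infinity>)\<close>, where the process is at the entrance time.

  Below \<open>x\<^sup>*\<close> the inequality is a hypothesis. The point is the equality on \<open>[x\<^sup>*, \<infinity>)\<close>, that is, the
  vanishing of the potential of \<open>f 1\<^bsub>(-\<infinity>, x\<^sup>*)\<^esub>\<close> at each \<open>x \<ge> x\<^sup>*\<close>; at \<open>x = x\<^sup>*\<close> it is a hypothesis.
  A process without negative jumps that starts at \<open>x \<ge> x\<^sup>*\<close> can only get below \<open>x\<^sup>*\<close> through the
  point \<open>x\<^sup>*\<close> itself (\<open>down_crossing\<close>); by the strong Markov property the potential at \<open>x\<close> is then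
  a multiple of the potential at \<open>x\<^sup>*\<close> (\<open>green_kernel_below_level\<close>).

  Entrance times of closed sets are obtained as limits of entrance times of decreasing open
  neighbourhoods, which are stopping times by right-continuity of the paths. For the upward
  entrance the limit is the entrance time itself, path by path, because a jump at the limiting
  time is upward (\<open>X_entrance_time\<close>). For the downward crossing such a jump could lead away from
  \<open>x\<^sup>*\<close>; left-quasi-continuity excludes this almost surely, and the limiting time is used in
  place of the entrance time.
\<close>

section \<open>Discounting and first entry times\<close>

text \<open>
  The factor \<open>e\<^bsup>-\<alpha>\<tau>\<^esup>\<close>, set to \<open>0\<close> on \<open>\<tau> = \<infinity>\<close>, so that products with it do not depend on the
  meaningless value of \<^const>\<open>at_time\<close> there.
\<close>

definition discount :: "real \<Rightarrow> ('a \<Rightarrow> ennreal) \<Rightarrow> 'a \<Rightarrow> real" where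
  "discount \<alpha> \<tau> \<omega> = (if \<tau> \<omega> = \<infinity> then 0 else exp (- \<alpha> * enn2real (\<tau> \<omega>)))"

lemma discount_nonneg [simp]: "0 \<le> discount \<alpha> \<tau> \<omega>"
  by (simp add: discount_def)

lemma discount_le_1: "0 < \<alpha> \<Longrightarrow> discount \<alpha> \<tau> \<omega> \<le> 1"
  by (simp add: discount_def)

lemma discount_measurable [measurable]:
  assumes [measurable]: "\<tau> \<in> borel_measurable N"
  shows "discount \<alpha> \<tau> \<in> borel_measurable N"
proof -
  have "discount \<alpha> \<tau> = (\<lambda>\<omega>. if \<tau> \<omega> < \<infinity> then exp (- \<alpha> * enn2real (\<tau> \<omega>)) else 0)"
    by (auto simp: discount_def fun_eq_iff less_top)
  then show ?thesis by simp
qed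

text \<open>
  The first entry time into an arbitrary set; it is \<open>\<infinity>\<close> on paths that never visit the set.
\<close>

definition first_entry :: "(real \<Rightarrow> 'a \<Rightarrow> real) \<Rightarrow> real set \<Rightarrow> 'a \<Rightarrow> ennreal" where
  "first_entry X A \<omega> = Inf {ennreal t | t. 0 \<le> t \<and> X t \<omega> \<in> A}"

lemma first_entry_le: "0 \<le> t \<Longrightarrow> X t \<omega> \<in> A \<Longrightarrow> first_entry X A \<omega> \<le> ennreal t"
  unfolding first_entry_def by (rule Inf_lower) auto

lemma first_entry_less_iff:
  "first_entry X A \<omega> < c \<longleftrightarrow> (\<exists>t\<ge>0. X t \<omega> \<in> A \<and> ennreal t < c)"
  unfolding first_entry_def Inf_less_iff by auto

lemma first_entry_antimono: "A \<subseteq> B \<Longrightarrow> first_entry X B \<omega> \<le> first_entry X A \<omega>"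
  unfolding first_entry_def by (rule Inf_superset_mono) auto

context standard_markov_process
begin

section \<open>Joint measurability of the paths and of the transition laws\<close>

text \<open>
  Only times \<open>t \<ge> 0\<close> are constrained, hence the truncation \<^term>\<open>max 0 s\<close> wherever time ranges
  over the whole real line.
\<close>

lemma X_measurable_pair:
  "(\<lambda>(s, \<omega>). X (max 0 s) \<omega>) \<in> borel_measurable (borel \<Otimes>\<^sub>M P x)"
proof (rule borel_measurable_LIMSEQ_metric)
  fix n :: nat
  have "(\<lambda>z. (min (max 0 (fst z)) (real n), snd z)) \<in>
      measurable (borel \<Otimes>\<^sub>M P x) (restrict_space borel {0..real n} \<Otimes>\<^sub>M P x)"
    by (intro measurable_Pair measurable_restrict_space2) auto
  from measurable_compose[OF this X_jointly_measurable[of "real n" x]]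
  show "(\<lambda>(s, \<omega>). X (min (max 0 s) (real n)) \<omega>) \<in> borel_measurable (borel \<Otimes>\<^sub>M P x)"
    by (simp add: case_prod_beta')
next
  fix z :: "real \<times> 'a"
  obtain m where "max 0 (fst z) \<le> real m" using real_arch_simple by blast
  then have "\<forall>\<^sub>F n in sequentially. (case z of (s, \<omega>) \<Rightarrow> X (max 0 s) \<omega>) =
      (case z of (s, \<omega>) \<Rightarrow> X (min (max 0 s) (real n)) \<omega>)"
    by (intro eventually_sequentiallyI[of m]) (auto simp: case_prod_beta' min_def)
  then show "(\<lambda>n. case z of (s, \<omega>) \<Rightarrow> X (min (max 0 s) (real n)) \<omega>)
      \<longlonglongrightarrow> (case z of (s, \<omega>) \<Rightarrow> X (max 0 s) \<omega>)"
    by (rule tendsto_eventually[OF eventually_mono]) simp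
qed

lemma X_measurable_random_time:
  assumes [measurable]: "T \<in> borel_measurable (P x)" and "\<And>\<omega>. 0 \<le> T \<omega>"
  shows "(\<lambda>\<omega>. X (T \<omega>) \<omega>) \<in> borel_measurable (P x)"
proof -
  have "(\<lambda>\<omega>. (T \<omega>, \<omega>)) \<in> measurable (P x) (borel \<Otimes>\<^sub>M P x)" by measurable
  from measurable_compose[OF this X_measurable_pair] show ?thesis
    by (simp add: assms(2) max_absorb2)
qed

lemma nn_integral_green_kernel:
  assumes [measurable]: "h \<in> borel_measurable borel"
  shows "(\<integral>\<^sup>+ y. h y \<partial>green_kernel P X \<alpha> x) =
    (\<integral>\<^sup>+ t. ennreal (exp (- \<alpha> * t)) * indicator {0..} t *
       (\<integral>\<^sup>+ \<omega>. h (X (max 0 t) \<omega>) \<partial>P x) \<partial>lborel)"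
proof -
  interpret prob_space "P x" by (rule prob_space_P)
  let ?w = "\<lambda>t. ennreal (exp (- \<alpha> * t)) * indicator {0..} t"
  let ?D = "density (lborel \<Otimes>\<^sub>M P x) (\<lambda>(t, \<omega>). ?w t)"
  let ?Y = "\<lambda>(t, \<omega>). X (max 0 t) \<omega>"
  have Y [measurable]: "?Y \<in> borel_measurable (lborel \<Otimes>\<^sub>M P x)"
    using X_measurable_pair by simp
  have "green_kernel P X \<alpha> x = distr ?D borel ?Y"
  proof (rule measure_eqI)
    fix H assume "H \<in> sets (green_kernel P X \<alpha> x)"
    then have H [measurable]: "H \<in> sets borel" by simp
    have "emeasure (distr ?D borel ?Y) H = (\<integral>\<^sup>+ z. indicator H (?Y z) \<partial>?D)"
      by (simp add: nn_integral_distr flip: nn_integral_indicator)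
    also have "\<dots> = (\<integral>\<^sup>+ z. (case z of (t, \<omega>) \<Rightarrow> ?w t) * indicator H (?Y z) \<partial>(lborel \<Otimes>\<^sub>M P x))"
      by (rule nn_integral_density) measurable
    also have "\<dots> = (\<integral>\<^sup>+ t. \<integral>\<^sup>+ \<omega>. ?w t * indicator H (X (max 0 t) \<omega>) \<partial>P x \<partial>lborel)"
      by (subst nn_integral_fst[symmetric]) auto
    also have "\<dots> = emeasure (green_kernel P X \<alpha> x) H"
      unfolding emeasure_green_kernel[OF H]
    proof (rule nn_integral_cong)
      fix t :: real
      have "(\<integral>\<^sup>+ \<omega>. ?w t * indicator H (X (max 0 t) \<omega>) \<partial>P x)
        = ?w t * (\<integral>\<^sup>+ \<omega>. indicator H (X (max 0 t) \<omega>) \<partial>P x)"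
        by (rule nn_integral_cmult) measurable
      also have "(\<integral>\<^sup>+ \<omega>. indicator H (X (max 0 t) \<omega>) \<partial>P x) =
         emeasure (P x) {\<omega> \<in> space (P x). X (max 0 t) \<omega> \<in> H}"
      proof -
        have "{\<omega> \<in> space (P x). X (max 0 t) \<omega> \<in> H} \<in> sets (P x)" by measurable
        from nn_integral_indicator[OF this] show ?thesis
          by (subst (asm) nn_integral_cong[where v="\<lambda>\<omega>. indicator H (X (max 0 t) \<omega>)"])
             (auto split: split_indicator)
      qed
      finally show "(\<integral>\<^sup>+ \<omega>. ?w t * indicator H (X (max 0 t) \<omega>) \<partial>P x) =
         ennreal (exp (- \<alpha> * t)) * emeasure (P x) {\<omega> \<in> space (P x). X t \<omega> \<in> H} * indicator {0..} t"
        by (simp split: split_indicator)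
    qed
    finally show "emeasure (green_kernel P X \<alpha> x) H = emeasure (distr ?D borel ?Y) H" ..
  qed simp
  then have "(\<integral>\<^sup>+ y. h y \<partial>green_kernel P X \<alpha> x) = (\<integral>\<^sup>+ z. h (?Y z) \<partial>?D)"
    by (simp add: nn_integral_distr)
  also have "\<dots> = (\<integral>\<^sup>+ z. (case z of (t, \<omega>) \<Rightarrow> ?w t) * h (?Y z) \<partial>(lborel \<Otimes>\<^sub>M P x))"
    by (rule nn_integral_density) measurable
  also have "\<dots> = (\<integral>\<^sup>+ t. \<integral>\<^sup>+ \<omega>. ?w t * h (X (max 0 t) \<omega>) \<partial>P x \<partial>lborel)"
    by (subst nn_integral_fst[symmetric]) auto
  also have "\<dots> = (\<integral>\<^sup>+ t. ?w t * (\<integral>\<^sup>+ \<omega>. h (X (max 0 t) \<omega>) \<partial>P x) \<partial>lborel)"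
    by (intro nn_integral_cong nn_integral_cmult) measurable
  finally show ?thesis .
qed

lemma nn_integral_law_measurable:
  fixes h :: "real \<Rightarrow> ennreal"
  assumes "0 \<le> t" and [measurable]: "h \<in> borel_measurable borel"
  shows "(\<lambda>y. \<integral>\<^sup>+ \<omega>. h (X t \<omega>) \<partial>P y) \<in> borel_measurable borel"
proof -
  have X [measurable]: "X t \<in> borel_measurable (P y)" for y using assms(1) by (rule X_measurable)
  have "(\<lambda>y. distr (P y) borel (X t)) \<in> borel \<rightarrow>\<^sub>M subprob_algebra borel"
  proof (rule measurable_subprob_algebra)
    fix H :: "real set" assume H [measurable]: "H \<in> sets borel"
    have "emeasure (distr (P y) borel (X t)) H = ennreal (measure (P y) {\<omega> \<in> space M. X t \<omega> \<in> H})" for y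
    proof -
      interpret prob_space "P y" by (rule prob_space_P)
      show ?thesis
        by (simp add: emeasure_distr vimage_def Int_def conj_commute space_P emeasure_eq_measure)
    qed
    then show "(\<lambda>y. emeasure (distr (P y) borel (X t)) H) \<in> borel_measurable borel"
      using kernel_measurable[OF assms(1) H] by simp
  qed (auto intro!: prob_space.prob_space_distr[OF prob_space_P] prob_space_imp_subprob_space)
  from nn_integral_measurable_subprob_algebra2[OF _ this, of "\<lambda>_. h"]
  show ?thesis by (simp add: nn_integral_distr)
qed

lemma law_right_continuous:
  fixes \<phi> :: "real \<Rightarrow> real"
  assumes "continuous_on UNIV \<phi>" "\<And>z. 0 \<le> \<phi> z" "\<And>z. \<phi> z \<le> 1"
    and "0 \<le> t" "\<And>n. t < s n" "s \<longlonglongrightarrow> t"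
  shows "(\<lambda>n. \<integral>\<^sup>+ \<omega>. ennreal (\<phi> (X (s n) \<omega>)) \<partial>P y) \<longlonglongrightarrow> (\<integral>\<^sup>+ \<omega>. ennreal (\<phi> (X t \<omega>)) \<partial>P y)"
proof -
  interpret prob_space "P y" by (rule prob_space_P)
  have [measurable]: "\<phi> \<in> borel_measurable borel"
    using assms(1) by (rule borel_measurable_continuous_onI)
  have s: "0 \<le> s n" for n using assms(4) assms(5)[of n] by simp
  have [measurable]: "X (s n) \<in> borel_measurable (P y)" "X t \<in> borel_measurable (P y)" for n
    using s assms(4) by (auto intro: X_measurable)
  have st: "filterlim s (at_right t) sequentially"
    using assms(5,6) by (auto simp: filterlim_at intro!: always_eventually less_imp_neq[symmetric])
  show ?thesis
  proof (rule nn_integral_dominated_convergence[where w="\<lambda>_. 1"])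
    show "AE \<omega> in P y. (\<lambda>n. ennreal (\<phi> (X (s n) \<omega>))) \<longlonglongrightarrow> ennreal (\<phi> (X t \<omega>))"
    proof (rule AE_I2, rule tendsto_ennrealI)
      fix \<omega> assume "\<omega> \<in> space (P y)"
      then have "(\<lambda>n. X (s n) \<omega>) \<longlonglongrightarrow> X t \<omega>"
        using filterlim_compose[OF right_continuous_paths st] assms(4) by (simp add: space_P)
      then show "(\<lambda>n. \<phi> (X (s n) \<omega>)) \<longlonglongrightarrow> \<phi> (X t \<omega>)"
        using assms(1) by (auto intro: isCont_tendsto_compose simp: continuous_on_eq_continuous_at)
    qed
  qed (auto simp: assms emeasure_space_1)
qed

text \<open>
  The locale only provides measurability of \<open>y \<mapsto> P\<^sub>y(X\<^sub>t \<in> H)\<close> for each fixed \<open>t\<close>; Tonelli's theorem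
  needs it jointly in \<open>(t, y)\<close>. For bounded continuous \<open>\<phi>\<close>, \<open>E\<^sub>y \<phi>(X\<^sub>t)\<close> is right-continuous in \<open>t\<close>
  and so a limit of functions that are piecewise constant in \<open>t\<close>. Indicators of rays \<open>(a, \<infinity>)\<close> are
  increasing limits of such \<open>\<phi>\<close>, and these rays generate the Borel sets.
\<close>

lemma law_kernel_measurable:
  "(\<lambda>(t, y). distr (P y) borel (X (max 0 t))) \<in> borel \<Otimes>\<^sub>M borel \<rightarrow>\<^sub>M subprob_algebra borel"
proof -
  let ?B = "borel \<Otimes>\<^sub>M borel :: (real \<times> real) measure"
  have X [measurable]: "X (max 0 t) \<in> borel_measurable (P y)" for t y by (rule X_measurable) simp
  have cont: "(\<lambda>(t, y). \<integral>\<^sup>+ \<omega>. ennreal (\<phi> (X (max 0 t) \<omega>)) \<partial>P y) \<in> borel_measurable ?B"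
    if \<phi>: "continuous_on UNIV \<phi>" "\<And>z. 0 \<le> \<phi> z" "\<And>z. \<phi> z \<le> (1::real)" for \<phi>
  proof -
    have [measurable]: "\<phi> \<in> borel_measurable borel"
      using \<phi>(1) by (rule borel_measurable_continuous_onI)
    \<comment> \<open>\<open>r n t\<close> is a point of the grid of mesh \<open>1 / (n + 1)\<close> strictly to the right of \<open>max 0 t\<close>.\<close>
    define r where "r n t = real_of_int (\<lfloor>max 0 t * real (Suc n)\<rfloor> + 1) / real (Suc n)" for n t
    have r: "max 0 t < r n t" "r n t \<le> max 0 t + 1 / real (Suc n)" for n t
    proof -
      let ?q = "max 0 t * real (Suc n)"
      have "?q < real_of_int (\<lfloor>?q\<rfloor> + 1)" "real_of_int (\<lfloor>?q\<rfloor> + 1) \<le> ?q + 1"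
        by linarith+
      then have "?q / real (Suc n) < r n t" "r n t \<le> (?q + 1) / real (Suc n)"
        unfolding r_def by (intro divide_strict_right_mono divide_right_mono; simp)+
      then show "max 0 t < r n t" "r n t \<le> max 0 t + 1 / real (Suc n)"
        by (simp_all add: add_divide_distrib del: of_nat_Suc)
    qed
    have lim: "(\<lambda>n. r n t) \<longlonglongrightarrow> max 0 t" for t
    proof (rule tendsto_sandwich[OF _ _ tendsto_const])
      show "(\<lambda>n. max 0 t + 1 / real (Suc n)) \<longlonglongrightarrow> max 0 t"
        using tendsto_add[OF tendsto_const LIMSEQ_inverse_real_of_nat, of "max 0 t"]
        by (simp add: inverse_eq_divide)
    qed (intro always_eventually allI less_imp_le[OF r(1)] r(2))+
    have m: "(\<lambda>(t, y). \<integral>\<^sup>+ \<omega>. ennreal (\<phi> (X (r n t) \<omega>)) \<partial>P y) \<in> borel_measurable ?B" for n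
    proof -
      \<comment> \<open>The truncation at \<open>0\<close> makes the time nonnegative for every integer \<open>k\<close>.\<close>
      have "(\<lambda>z. \<integral>\<^sup>+ \<omega>. ennreal (\<phi> (X (real_of_int (max 0 (k + 1)) / real (Suc n)) \<omega>)) \<partial>P (snd z))
          \<in> borel_measurable ?B" for k
        by (rule measurable_compose[OF measurable_snd nn_integral_law_measurable]) auto
      from measurable_compose_countable[OF this, where g = "\<lambda>z. \<lfloor>max 0 (fst z) * real (Suc n)\<rfloor>"]
      have "(\<lambda>z. \<integral>\<^sup>+ \<omega>. ennreal (\<phi> (X (real_of_int (max 0 (\<lfloor>max 0 (fst z) * real (Suc n)\<rfloor> + 1)) / real (Suc n)) \<omega>)) \<partial>P (snd z))
          \<in> borel_measurable ?B"
        by measurable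
      moreover have "max 0 (\<lfloor>max 0 t * real (Suc n)\<rfloor> + 1) = \<lfloor>max 0 t * real (Suc n)\<rfloor> + 1" for t
        by (simp add: max_def)
      ultimately show ?thesis
        by (simp add: r_def case_prod_beta')
    qed
    have "(\<lambda>z. liminf (\<lambda>n. case z of (t, y) \<Rightarrow> \<integral>\<^sup>+ \<omega>. ennreal (\<phi> (X (r n t) \<omega>)) \<partial>P y)) \<in> borel_measurable ?B"
      using m by (rule borel_measurable_liminf)
    moreover have "liminf (\<lambda>n. case z of (t, y) \<Rightarrow> \<integral>\<^sup>+ \<omega>. ennreal (\<phi> (X (r n t) \<omega>)) \<partial>P y) =
        (case z of (t, y) \<Rightarrow> \<integral>\<^sup>+ \<omega>. ennreal (\<phi> (X (max 0 t) \<omega>)) \<partial>P y)" for z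
      using law_right_continuous[OF \<phi> _ r(1) lim]
      by (auto simp: case_prod_beta' intro!: lim_imp_Liminf)
    ultimately show ?thesis by simp
  qed
  have ray: "(\<lambda>(t, y). emeasure (distr (P y) borel (X (max 0 t))) {a<..}) \<in> borel_measurable ?B"
    for a :: real
  proof -
    define \<phi> where "\<phi> n z = min 1 (real n * max 0 (z - a))" for n z
    have \<phi>: "continuous_on UNIV (\<phi> n)" "\<And>z. 0 \<le> \<phi> n z" "\<And>z. \<phi> n z \<le> 1" for n
      unfolding \<phi>_def by (auto intro!: continuous_intros)
    have [measurable]: "\<phi> n \<in> borel_measurable borel" for n
      using \<phi>(1) by (rule borel_measurable_continuous_onI)
    have "(SUP n. ennreal (\<phi> n z)) = indicator {a<..} z" for z
    proof (cases "a < z")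
      case True
      then obtain n where "1 / (z - a) \<le> real n" using real_arch_simple by blast
      then have "1 \<le> real n * (z - a)" using True by (simp add: field_simps)
      then have "ennreal (\<phi> n z) = 1" using True by (simp add: \<phi>_def)
      then show ?thesis using True \<phi>(3)
        by (intro antisym SUP_upper2[of n] SUP_least) auto
    qed (simp add: \<phi>_def)
    moreover have "incseq (\<lambda>n \<omega>. ennreal (\<phi> n (X (max 0 t) \<omega>)))" for t
      unfolding \<phi>_def
      by (intro incseq_SucI le_funI ennreal_leI min.mono order_refl mult_right_mono) auto
    ultimately have "(SUP n. \<integral>\<^sup>+ \<omega>. ennreal (\<phi> n (X (max 0 t) \<omega>)) \<partial>P y)
        = emeasure (distr (P y) borel (X (max 0 t))) {a<..}" for t y
      by (simp add: nn_integral_distr flip: nn_integral_monotone_convergence_SUP nn_integral_indicator)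
    moreover have "(\<lambda>z. SUP n. case z of (t, y) \<Rightarrow> \<integral>\<^sup>+ \<omega>. ennreal (\<phi> n (X (max 0 t) \<omega>)) \<partial>P y) \<in> borel_measurable ?B"
      using cont[OF \<phi>] by (intro borel_measurable_SUP) auto
    ultimately show ?thesis by (simp add: case_prod_beta')
  qed
  show ?thesis
  proof (rule measurable_prob_algebraD, rule measurable_prob_algebra_generated)
    show "sets borel = sigma_sets UNIV (range (\<lambda>a::real. {a<..}))"
      by (subst borel_Ioi) simp
    show "Int_stable (range (\<lambda>a::real. {a<..}))"
    proof (rule Int_stableI_image)
      fix a b :: real
      have "{a<..} \<inter> {b<..} = {max a b<..}" by auto
      then show "\<exists>c\<in>UNIV. {a<..} \<inter> {b<..} = {c<..}" by blast
    qed
  qed (use ray in \<open>auto simp: case_prod_beta' intro!: prob_space.prob_space_distr[OF prob_space_P]\<close>)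
qed

lemma nn_integral_law_measurable_pair [measurable]:
  fixes h :: "real \<Rightarrow> ennreal"
  assumes [measurable]: "h \<in> borel_measurable borel"
  shows "(\<lambda>(t, y). \<integral>\<^sup>+ \<omega>. h (X (max 0 t) \<omega>) \<partial>P y) \<in> borel_measurable (borel \<Otimes>\<^sub>M borel)"
proof -
  have X [measurable]: "X (max 0 t) \<in> borel_measurable (P y)" for t y by (rule X_measurable) simp
  from nn_integral_measurable_subprob_algebra2[OF _ law_kernel_measurable, of "\<lambda>_. h"]
  show ?thesis by (simp add: case_prod_beta' nn_integral_distr)
qed

section \<open>Stopping times\<close>

lemma at_time_measurable_P [measurable]:
  "\<tau> \<in> borel_measurable (P x) \<Longrightarrow> at_time X \<tau> \<in> borel_measurable (P x)"
  unfolding at_time_def by (rule X_measurable_random_time) auto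

lemma stopping_time_measurable: "is_stopping_time M F \<tau> \<Longrightarrow> \<tau> \<in> borel_measurable (P x)"
  using measurable_cong_sets[OF sets_P[of x] refl, of borel] unfolding is_stopping_time_def by blast

text \<open>
  By right-continuity of the filtration, \<open>\<tau> \<le> t\<close> and \<open>\<tau> < t\<close> are interchangeable in the notion of
  stopping time; \<open>is_stopping_timeI\<close> is the converse direction.
\<close>

lemma stopping_time_le:
  assumes "is_stopping_time M F \<tau>" "0 \<le> t"
  shows "{\<omega> \<in> space M. \<tau> \<omega> \<le> ennreal t} \<in> sets (F t)"
  unfolding right_continuous_F[OF assms(2)]
proof safe
  fix s assume s: "t < s"
  define u where "u n = t + (s - t) / real (Suc n)" for n
  have u: "t < u n" "u n \<le> s" for n
  proof -
    have "(s - t) / real (Suc n) \<le> (s - t) / 1"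
      using s by (intro divide_left_mono) auto
    then show "t < u n" "u n \<le> s" using s by (simp_all add: u_def)
  qed
  have "(\<lambda>n. t + (s - t) * inverse (real (Suc n))) \<longlonglongrightarrow> t + (s - t) * 0"
    by (intro tendsto_intros LIMSEQ_inverse_real_of_nat)
  then have lim: "u \<longlonglongrightarrow> t"
    by (simp add: u_def [abs_def] divide_inverse)
  have "{\<omega> \<in> space M. \<tau> \<omega> < ennreal (u n)} \<in> sets (F s)" for n
    using assms u[of n] mono_F[of "u n" s] by (auto simp: is_stopping_time_def)
  then have "(\<Inter>n. {\<omega> \<in> space M. \<tau> \<omega> < ennreal (u n)}) \<in> sets (F s)"
    by (intro sets.countable_INT) auto
  also have "(\<Inter>n. {\<omega> \<in> space M. \<tau> \<omega> < ennreal (u n)}) = {\<omega> \<in> space M. \<tau> \<omega> \<le> ennreal t}"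
  proof safe
    fix \<omega> assume "\<omega> \<in> (\<Inter>n. {\<omega> \<in> space M. \<tau> \<omega> < ennreal (u n)})"
    then have "\<tau> \<omega> \<le> ennreal (u n)" for n by (auto intro: less_imp_le)
    then show "\<tau> \<omega> \<le> ennreal t"
      by (intro tendsto_le[OF sequentially_bot tendsto_ennrealI[OF lim] tendsto_const]) auto
  next
    fix \<omega> n assume "\<tau> \<omega> \<le> ennreal t"
    also have "\<dots> < ennreal (u n)" using u(1)[of n] assms(2) by (simp add: ennreal_less_iff)
    finally show "\<tau> \<omega> < ennreal (u n)" .
  qed auto
  finally show "{\<omega> \<in> space M. \<tau> \<omega> \<le> ennreal t} \<in> sets (F s)" .
qed

lemma sets_F_subset: "0 \<le> t \<Longrightarrow> sets (F t) \<subseteq> sets M" and space_F: "0 \<le> t \<Longrightarrow> space (F t) = space M"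
  using subalgebra_F[of t] by (auto simp: subalgebra_def)

lemma is_stopping_timeI_less:
  assumes "\<And>t. 0 \<le> t \<Longrightarrow> {\<omega> \<in> space M. \<tau> \<omega> < ennreal t} \<in> sets (F t)"
  shows "is_stopping_time M F \<tau>"
  unfolding is_stopping_time_def
proof (intro conjI allI impI borel_measurableI_less)
  have fin: "{\<omega> \<in> space M. \<tau> \<omega> < ennreal t} \<in> sets M" if "0 \<le> t" for t
    using assms[OF that] sets_F_subset[OF that] by blast
  fix a :: ennreal
  show "{\<omega> \<in> space M. \<tau> \<omega> < a} \<in> sets M"
  proof (cases a)
    case top
    have "(\<Union>n. {\<omega> \<in> space M. \<tau> \<omega> < ennreal (real n)}) \<in> sets M"
      using fin by (intro sets.countable_UN) auto
    also have "(\<Union>n. {\<omega> \<in> space M. \<tau> \<omega> < ennreal (real n)}) = {\<omega> \<in> space M. \<tau> \<omega> < a}"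
      using ennreal_Ex_less_of_nat
      by (auto simp: top ennreal_of_nat_eq_real_of_nat intro: less_trans[OF _ ennreal_less_top])
    finally show ?thesis .
  qed (use fin in simp)
qed (rule assms)

lemma is_stopping_timeI:
  assumes "\<And>t. 0 \<le> t \<Longrightarrow> {\<omega> \<in> space M. \<tau> \<omega> \<le> ennreal t} \<in> sets (F t)"
  shows "is_stopping_time M F \<tau>"
proof (rule is_stopping_timeI_less)
  fix t :: real assume t: "0 \<le> t"
  define u where "u n = t - t / real (Suc n)" for n
  have u: "0 \<le> u n" "u n \<le> t" for n using t by (simp_all add: u_def field_simps)
  have "(\<lambda>n. t - t * inverse (real (Suc n))) \<longlonglongrightarrow> t - t * 0"
    by (intro tendsto_intros LIMSEQ_inverse_real_of_nat)
  then have lim: "u \<longlonglongrightarrow> t"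
    by (simp add: u_def [abs_def] divide_inverse)
  have "{\<omega> \<in> space M. \<tau> \<omega> \<le> ennreal (u n)} \<in> sets (F t)" for n
    using assms[OF u(1)] mono_F[OF u] by auto
  then have 1: "(\<Union>n. {\<omega> \<in> space M. \<tau> \<omega> \<le> ennreal (u n)}) \<in> sets (F t)"
    by (intro sets.countable_UN) auto
  show "{\<omega> \<in> space M. \<tau> \<omega> < ennreal t} \<in> sets (F t)"
  proof (cases "t = 0")
    case False
    have "(\<Union>n. {\<omega> \<in> space M. \<tau> \<omega> \<le> ennreal (u n)}) = {\<omega> \<in> space M. \<tau> \<omega> < ennreal t}"
    proof safe
      fix \<omega> n assume "\<tau> \<omega> \<le> ennreal (u n)"
      also have "\<dots> < ennreal t" using t u[of n] False by (auto simp: ennreal_less_iff u_def)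
      finally show "\<tau> \<omega> < ennreal t" .
    next
      fix \<omega> assume \<omega>: "\<omega> \<in> space M" "\<tau> \<omega> < ennreal t"
      then have "\<forall>\<^sub>F n in sequentially. \<tau> \<omega> < ennreal (u n)"
        using order_tendstoD(1)[OF tendsto_ennrealI[OF lim]] by blast
      then obtain n where "\<tau> \<omega> < ennreal (u n)"
        using eventually_happens'[OF sequentially_bot] by blast
      with \<omega> show "\<omega> \<in> (\<Union>n. {\<omega> \<in> space M. \<tau> \<omega> \<le> ennreal (u n)})"
        by (auto intro: less_imp_le)
    qed
    with 1 show ?thesis by simp
  qed (simp)
qed

lemma space_sigma_at: "space (sigma_at M F \<tau>) = space M"
  by (simp add: sigma_at_def space_measure_of_conv)

lemma sets_sigma_at:
  "sets (sigma_at M F \<tau>) =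
    sigma_sets (space M) {A \<in> sets M. \<forall>t\<ge>0. {\<omega> \<in> A. \<tau> \<omega> \<le> ennreal t} \<in> sets (F t)}"
  unfolding sigma_at_def using sets.space_closed[of M] by (intro sets_measure_of) auto

lemma subalgebra_sigma_at: "subalgebra (P x) (sigma_at M F \<tau>)"
  unfolding subalgebra_def space_sigma_at sets_sigma_at space_P sets_P
  by (intro conjI refl sets.sigma_sets_subset) blast

lemma stopping_time_sigma_at:
  assumes "is_stopping_time M F \<tau>"
  shows "\<tau> \<in> borel_measurable (sigma_at M F \<tau>)"
proof (rule borel_measurableI_le)
  fix a :: ennreal
  show "{\<omega> \<in> space (sigma_at M F \<tau>). \<tau> \<omega> \<le> a} \<in> sets (sigma_at M F \<tau>)"
  proof -
    let ?A = "{\<omega> \<in> space M. \<tau> \<omega> \<le> a}"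
    have "{\<omega> \<in> ?A. \<tau> \<omega> \<le> ennreal t} \<in> sets (F t)" if t: "0 \<le> t" for t
    proof (cases "a = \<infinity>")
      case False
      define u where "u = min (enn2real a) t"
      have u: "0 \<le> u" "u \<le> t" using t by (auto simp: u_def)
      have "{\<omega> \<in> ?A. \<tau> \<omega> \<le> ennreal t} = {\<omega> \<in> space M. \<tau> \<omega> \<le> ennreal u}"
        using False t by (cases a) (auto simp: u_def min_def intro: order_trans)
      with stopping_time_le[OF assms u(1)] mono_F[OF u] show ?thesis by auto
    qed (use stopping_time_le[OF assms t] in simp)
    moreover have "?A \<in> sets M"
      using assms borel_measurable_le[of \<tau> M "\<lambda>_. a"] by (simp add: is_stopping_time_def)
    ultimately show ?thesis
      unfolding space_sigma_at sets_sigma_at by (intro sigma_sets.Basic) auto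
  qed
qed

section \<open>Green potentials and the strong Markov property\<close>

text \<open>
  The strong Markov property for a constant delay \<open>s\<close> after \<open>\<tau>\<close>, extended from indicators to
  nonnegative Borel functions and integrated against the \<open>\<F>\<^sub>\<tau>\<close>-measurable discount factor.
\<close>

lemma strong_markov_nn_integral:
  assumes \<tau>: "is_stopping_time M F \<tau>" and "0 < \<alpha>" "0 \<le> s" and h: "h \<in> borel_measurable borel"
  shows "(\<integral>\<^sup>+ \<omega>. ennreal (discount \<alpha> \<tau> \<omega>) * (\<integral>\<^sup>+ \<omega>'. h (X s \<omega>') \<partial>P (at_time X \<tau> \<omega>)) \<partial>P x) =
    (\<integral>\<^sup>+ \<omega>. ennreal (discount \<alpha> \<tau> \<omega>) * h (X (enn2real (\<tau> \<omega>) + s) \<omega>) \<partial>P x)"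
  using h
proof (induct h)
  interpret prob_space "P x" by (rule prob_space_P)
  interpret sigma_finite_subalgebra "P x" "sigma_at M F \<tau>"
    by (intro finite_measure_subalgebra_is_sigma_finite finite_measure_subalgebra.intro
      finite_measure_subalgebra_axioms.intro subalgebra_sigma_at) unfold_locales
  note [measurable] = stopping_time_measurable[OF \<tau>] X_measurable[OF \<open>0 \<le> s\<close>]
  have X\<tau> [measurable]: "(\<lambda>\<omega>. X (enn2real (\<tau> \<omega>) + s) \<omega>) \<in> borel_measurable (P x)"
    using \<open>0 \<le> s\<close> by (intro X_measurable_random_time) auto
  {
    case (cong f g)
    then show ?case by (simp cong: nn_integral_cong)
  next
    case (set H)
    note [measurable] = \<open>H \<in> sets borel\<close>
    let ?A = "{\<omega>' \<in> space M. \<tau> \<omega>' < \<infinity> \<and> X (enn2real (\<tau> \<omega>') + s) \<omega>' \<in> H}"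
    let ?d = "discount \<alpha> \<tau>"
    let ?q = "\<lambda>\<omega>. measure (P (at_time X \<tau> \<omega>)) {\<omega>' \<in> space M. X s \<omega>' \<in> H}"
    have A [measurable]: "?A \<in> sets (P x)" unfolding space_P[of x, symmetric] by measurable
    have [measurable]: "?q \<in> borel_measurable (P x)"
      using measurable_compose[OF at_time_measurable_P kernel_measurable[OF \<open>0 \<le> s\<close> set], of \<tau>] by simp
    have q1: "?q \<omega> \<le> 1" for \<omega> by (intro prob_space.prob_le_1 prob_space_P)
    have d1: "?d \<omega> \<le> 1" for \<omega> using \<open>0 < \<alpha>\<close> by (rule discount_le_1)
    have int: "integrable (P x) (\<lambda>\<omega>. ?d \<omega> * ?q \<omega>)"
      by (rule integrable_const_bound[where B=1]) (auto intro!: mult_le_one q1 d1)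
    have int': "integrable (P x) (\<lambda>\<omega>. ?d \<omega> * indicator ?A \<omega>)"
    proof (rule integrable_const_bound[where B=1])
      show "(\<lambda>\<omega>. ?d \<omega> * indicator ?A \<omega>) \<in> borel_measurable (P x)"
        by (intro borel_measurable_times borel_measurable_indicator A) measurable
    qed (auto intro!: mult_le_one d1 split: split_indicator)
    \<comment> \<open>Where \<open>\<tau> = \<infinity>\<close> and \<open>strong_markov\<close> is silent, the discount factor vanishes.\<close>
    have "(\<integral>\<omega>. ?d \<omega> * ?q \<omega> \<partial>P x) = (\<integral>\<omega>. ?d \<omega> * real_cond_exp (P x) (sigma_at M F \<tau>) (indicator ?A) \<omega> \<partial>P x)"
    proof (rule integral_cong_AE)
      show "AE \<omega> in P x. ?d \<omega> * ?q \<omega> = ?d \<omega> * real_cond_exp (P x) (sigma_at M F \<tau>) (indicator ?A) \<omega>"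
        using strong_markov[OF \<tau> \<open>0 \<le> s\<close> set, of x]
        by eventually_elim (auto simp: discount_def less_top)
    qed measurable
    also have "\<dots> = (\<integral>\<omega>. ?d \<omega> * indicator ?A \<omega> \<partial>P x)"
      using int' discount_measurable[OF stopping_time_sigma_at[OF \<tau>]] by (rule real_cond_exp_intg(2)) measurable
    finally have eq: "(\<integral>\<omega>. ?d \<omega> * ?q \<omega> \<partial>P x) = (\<integral>\<omega>. ?d \<omega> * indicator ?A \<omega> \<partial>P x)" .
    have q: "(\<integral>\<^sup>+ \<omega>'. indicator H (X s \<omega>') \<partial>P y) = ennreal (measure (P y) {\<omega>' \<in> space M. X s \<omega>' \<in> H})" for y
    proof -
      interpret y: prob_space "P y" by (rule prob_space_P)
      have B: "{\<omega>' \<in> space M. X s \<omega>' \<in> H} \<in> sets (P y)"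
        unfolding space_P[of y, symmetric] by measurable
      have "(\<integral>\<^sup>+ \<omega>'. indicator H (X s \<omega>') \<partial>P y) = (\<integral>\<^sup>+ \<omega>'. indicator {\<omega>' \<in> space M. X s \<omega>' \<in> H} \<omega>' \<partial>P y)"
        by (intro nn_integral_cong) (auto split: split_indicator simp: space_P)
      with B show ?thesis by (simp add: y.emeasure_eq_measure)
    qed
    have "(\<integral>\<^sup>+ \<omega>. ennreal (?d \<omega>) * (\<integral>\<^sup>+ \<omega>'. indicator H (X s \<omega>') \<partial>P (at_time X \<tau> \<omega>)) \<partial>P x)
       = (\<integral>\<^sup>+ \<omega>. ennreal (?d \<omega> * ?q \<omega>) \<partial>P x)"
      by (simp add: q ennreal_mult)
    also have "\<dots> = ennreal (\<integral>\<omega>. ?d \<omega> * indicator ?A \<omega> \<partial>P x)"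
      using int by (simp add: nn_integral_eq_integral eq)
    also have "\<dots> = (\<integral>\<^sup>+ \<omega>. ennreal (?d \<omega> * indicator ?A \<omega>) \<partial>P x)"
      using int' by (simp add: nn_integral_eq_integral)
    also have "\<dots> = (\<integral>\<^sup>+ \<omega>. ennreal (?d \<omega>) * indicator H (X (enn2real (\<tau> \<omega>) + s) \<omega>) \<partial>P x)"
      by (intro nn_integral_cong) (auto split: split_indicator simp: space_P discount_def less_top)
    finally show ?case .
  next
    case (mult u c)
    note [measurable] = mult(2)
    have m [measurable]: "(\<lambda>\<omega>. \<integral>\<^sup>+ \<omega>'. u (X s \<omega>') \<partial>P (at_time X \<tau> \<omega>)) \<in> borel_measurable (P x)"
      using measurable_compose[OF at_time_measurable_P nn_integral_law_measurable[OF \<open>0 \<le> s\<close> mult(2)], of \<tau>] by simp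
    have X [measurable]: "X s \<in> borel_measurable (P y)" for y using \<open>0 \<le> s\<close> by (rule X_measurable)
    show ?case
      using mult(4)
      by (simp add: nn_integral_cmult mult.left_commute[of _ c])
  next
    case (add u v)
    note [measurable] = add(1,4)
    have m [measurable]: "(\<lambda>\<omega>. \<integral>\<^sup>+ \<omega>'. w (X s \<omega>') \<partial>P (at_time X \<tau> \<omega>)) \<in> borel_measurable (P x)"
       if "w \<in> borel_measurable borel" for w
      using measurable_compose[OF at_time_measurable_P nn_integral_law_measurable[OF \<open>0 \<le> s\<close> that], of \<tau>] by simp
    have X [measurable]: "X s \<in> borel_measurable (P y)" for y using \<open>0 \<le> s\<close> by (rule X_measurable)
    show ?case
      using add
      by (simp add: nn_integral_add distrib_left)
  next
    case (seq U)
    note [measurable] = seq(1)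
    have m [measurable]: "(\<lambda>\<omega>. \<integral>\<^sup>+ \<omega>'. U i (X s \<omega>') \<partial>P (at_time X \<tau> \<omega>)) \<in> borel_measurable (P x)" for i
      using measurable_compose[OF at_time_measurable_P nn_integral_law_measurable[OF \<open>0 \<le> s\<close> seq(1)], of \<tau>] by simp
    have X [measurable]: "X s \<in> borel_measurable (P y)" for y using \<open>0 \<le> s\<close> by (rule X_measurable)
    have incU: "i \<le> j \<Longrightarrow> U i z \<le> U j z" for i j z
      using seq(4) by (auto simp: incseq_def le_fun_def)
    have "(\<integral>\<^sup>+ \<omega>. ennreal (discount \<alpha> \<tau> \<omega>) * (\<integral>\<^sup>+ \<omega>'. (SUP i. U i) (X s \<omega>') \<partial>P (at_time X \<tau> \<omega>)) \<partial>P x)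
      = (\<integral>\<^sup>+ \<omega>. (SUP i. ennreal (discount \<alpha> \<tau> \<omega>) * (\<integral>\<^sup>+ \<omega>'. U i (X s \<omega>') \<partial>P (at_time X \<tau> \<omega>))) \<partial>P x)"
      unfolding SUP_apply
      by (subst nn_integral_monotone_convergence_SUP)
         (auto intro!: incseq_SucI le_funI incU simp: SUP_mult_left_ennreal)
    also have "\<dots> = (SUP i. \<integral>\<^sup>+ \<omega>. ennreal (discount \<alpha> \<tau> \<omega>) * (\<integral>\<^sup>+ \<omega>'. U i (X s \<omega>') \<partial>P (at_time X \<tau> \<omega>)) \<partial>P x)"
      by (intro nn_integral_monotone_convergence_SUP incseq_SucI le_funI mult_left_mono nn_integral_mono incU) auto
    also have "\<dots> = (SUP i. \<integral>\<^sup>+ \<omega>. ennreal (discount \<alpha> \<tau> \<omega>) * U i (X (enn2real (\<tau> \<omega>) + s) \<omega>) \<partial>P x)"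
      by (simp add: seq(3))
    also have "\<dots> = (\<integral>\<^sup>+ \<omega>. (SUP i. ennreal (discount \<alpha> \<tau> \<omega>) * U i (X (enn2real (\<tau> \<omega>) + s) \<omega>)) \<partial>P x)"
      by (intro nn_integral_monotone_convergence_SUP[symmetric] incseq_SucI le_funI mult_left_mono incU) auto
    also have "\<dots> = (\<integral>\<^sup>+ \<omega>. ennreal (discount \<alpha> \<tau> \<omega>) * (SUP i. U i) (X (enn2real (\<tau> \<omega>) + s) \<omega>) \<partial>P x)"
      unfolding SUP_apply by (simp add: SUP_mult_left_ennreal)
    finally show ?case .
  }
qed

lemma nn_integral_green_kernel_paths:
  assumes [measurable]: "h \<in> borel_measurable borel"
  shows "(\<integral>\<^sup>+ y. h y \<partial>green_kernel P X \<alpha> x) =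
    (\<integral>\<^sup>+ \<omega>. \<integral>\<^sup>+ t. ennreal (exp (- \<alpha> * t)) * indicator {0..} t * h (X (max 0 t) \<omega>) \<partial>lborel \<partial>P x)"
proof -
  interpret prob_space "P x" by (rule prob_space_P)
  interpret L: pair_sigma_finite lborel "P x" ..
  have X [measurable]: "X (max 0 t) \<in> borel_measurable (P y)" for t y by (rule X_measurable) simp
  have [measurable]: "(\<lambda>z. X (max 0 (fst z)) (snd z)) \<in> borel_measurable (lborel \<Otimes>\<^sub>M P x)"
    using X_measurable_pair[of x] by (simp add: case_prod_beta')
  have "(\<integral>\<^sup>+ y. h y \<partial>green_kernel P X \<alpha> x) =
      (\<integral>\<^sup>+ t. \<integral>\<^sup>+ \<omega>. ennreal (exp (- \<alpha> * t)) * indicator {0..} t * h (X (max 0 t) \<omega>) \<partial>P x \<partial>lborel)"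
    by (simp add: nn_integral_green_kernel nn_integral_cmult)
  also have "\<dots> = (\<integral>\<^sup>+ \<omega>. \<integral>\<^sup>+ t. ennreal (exp (- \<alpha> * t)) * indicator {0..} t * h (X (max 0 t) \<omega>) \<partial>lborel \<partial>P x)"
    by (rule L.Fubini'[symmetric]) (simp add: case_prod_beta')
  finally show ?thesis .
qed

lemma X_measurable_path:
  assumes "\<omega> \<in> space M"
  shows "(\<lambda>t. X (max 0 t) \<omega>) \<in> borel_measurable borel"
proof -
  have "(\<lambda>t. (t, \<omega>)) \<in> measurable borel (borel \<Otimes>\<^sub>M P 0)"
    using assms by (intro measurable_Pair) (auto simp: space_P)
  from measurable_compose[OF this X_measurable_pair] show ?thesis by simp
qed

lemma discounted_green_kernel_at_stopping_time:
  assumes \<tau>: "is_stopping_time M F \<tau>" and "0 < \<alpha>" and [measurable]: "h \<in> borel_measurable borel"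
  shows "(\<integral>\<^sup>+ \<omega>. ennreal (discount \<alpha> \<tau> \<omega>) * (\<integral>\<^sup>+ y. h y \<partial>green_kernel P X \<alpha> (at_time X \<tau> \<omega>)) \<partial>P x) =
    (\<integral>\<^sup>+ \<omega>. \<integral>\<^sup>+ t. ennreal (exp (- \<alpha> * t)) * indicator {t. 0 \<le> t \<and> \<tau> \<omega> \<le> ennreal t} t *
       h (X (max 0 t) \<omega>) \<partial>lborel \<partial>P x)"
proof -
  interpret prob_space "P x" by (rule prob_space_P)
  interpret L: pair_sigma_finite lborel "P x" ..
  note [measurable] = stopping_time_measurable[OF \<tau>]
  let ?d = "\<lambda>\<omega>. ennreal (discount \<alpha> \<tau> \<omega>)"
  let ?e = "\<lambda>t. ennreal (exp (- \<alpha> * t)) * indicator {0..} t"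
  let ?Q = "\<lambda>t y. \<integral>\<^sup>+ \<omega>. h (X (max 0 t) \<omega>) \<partial>P y"
  have Q [measurable]: "(\<lambda>z. ?Q (fst z) (at_time X \<tau> (snd z))) \<in> borel_measurable (lborel \<Otimes>\<^sub>M P x)"
  proof -
    have "(\<lambda>z. (fst z, at_time X \<tau> (snd z))) \<in> lborel \<Otimes>\<^sub>M P x \<rightarrow>\<^sub>M borel \<Otimes>\<^sub>M borel"
      by measurable
    from measurable_compose[OF this nn_integral_law_measurable_pair] show ?thesis by simp
  qed
  have Qt [measurable]: "(\<lambda>\<omega>. ?Q t (at_time X \<tau> \<omega>)) \<in> borel_measurable (P x)" for t
    using measurable_compose[OF measurable_Pair1' Q, of t] by simp
  have Q\<omega>: "(\<lambda>t. ?Q t y) \<in> borel_measurable lborel" for y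
    using measurable_compose[OF measurable_Pair2'[of y borel borel] nn_integral_law_measurable_pair[OF assms(3)]] by simp
  have Y: "(\<lambda>z. X (enn2real (\<tau> (snd z)) + max 0 (fst z)) (snd z)) \<in> borel_measurable (lborel \<Otimes>\<^sub>M P x)"
  proof -
    have "(\<lambda>z. (enn2real (\<tau> (snd z)) + max 0 (fst z), snd z)) \<in> lborel \<Otimes>\<^sub>M P x \<rightarrow>\<^sub>M borel \<Otimes>\<^sub>M P x"
      by measurable
    from measurable_compose[OF this X_measurable_pair] show ?thesis by (simp add: max_absorb2)
  qed
  note [measurable] = Y
  have Yt [measurable]: "(\<lambda>\<omega>. X (enn2real (\<tau> \<omega>) + max 0 t) \<omega>) \<in> borel_measurable (P x)" for t
    using measurable_compose[OF measurable_Pair1' Y, of t] by simp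
  have "(\<integral>\<^sup>+ \<omega>. ?d \<omega> * (\<integral>\<^sup>+ y. h y \<partial>green_kernel P X \<alpha> (at_time X \<tau> \<omega>)) \<partial>P x) =
      (\<integral>\<^sup>+ \<omega>. \<integral>\<^sup>+ t. ?d \<omega> * (?e t * ?Q t (at_time X \<tau> \<omega>)) \<partial>lborel \<partial>P x)"
    using Q\<omega> by (simp add: nn_integral_green_kernel nn_integral_cmult)
  also have "\<dots> = (\<integral>\<^sup>+ t. \<integral>\<^sup>+ \<omega>. ?d \<omega> * (?e t * ?Q t (at_time X \<tau> \<omega>)) \<partial>P x \<partial>lborel)"
    by (rule L.Fubini') (simp add: case_prod_beta')
  also have "\<dots> = (\<integral>\<^sup>+ t. ?e t * (\<integral>\<^sup>+ \<omega>. ?d \<omega> * ?Q t (at_time X \<tau> \<omega>) \<partial>P x) \<partial>lborel)"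
    by (intro nn_integral_cong) (simp add: mult.left_commute[of "ennreal (discount _ _ _)"] nn_integral_cmult)
  also have "\<dots> = (\<integral>\<^sup>+ t. ?e t * (\<integral>\<^sup>+ \<omega>. ?d \<omega> * h (X (enn2real (\<tau> \<omega>) + max 0 t) \<omega>) \<partial>P x) \<partial>lborel)"
    using assms by (simp add: strong_markov_nn_integral)
  also have "\<dots> = (\<integral>\<^sup>+ t. \<integral>\<^sup>+ \<omega>. ?e t * (?d \<omega> * h (X (enn2real (\<tau> \<omega>) + max 0 t) \<omega>)) \<partial>P x \<partial>lborel)"
    by (simp add: nn_integral_cmult)
  also have "\<dots> = (\<integral>\<^sup>+ \<omega>. \<integral>\<^sup>+ t. ?e t * (?d \<omega> * h (X (enn2real (\<tau> \<omega>) + max 0 t) \<omega>)) \<partial>lborel \<partial>P x)"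
    by (rule L.Fubini'[symmetric]) (simp add: case_prod_beta')
  also have "\<dots> = (\<integral>\<^sup>+ \<omega>. \<integral>\<^sup>+ t. ennreal (exp (- \<alpha> * t)) * indicator {t. 0 \<le> t \<and> \<tau> \<omega> \<le> ennreal t} t *
       h (X (max 0 t) \<omega>) \<partial>lborel \<partial>P x)"
  proof (rule nn_integral_cong)
    fix \<omega> assume "\<omega> \<in> space (P x)"
    then have [measurable]: "(\<lambda>t. X (max 0 t) \<omega>) \<in> borel_measurable borel"
      using X_measurable_path by (simp add: space_P)
    show "(\<integral>\<^sup>+ t. ?e t * (?d \<omega> * h (X (enn2real (\<tau> \<omega>) + max 0 t) \<omega>)) \<partial>lborel) =
      (\<integral>\<^sup>+ t. ennreal (exp (- \<alpha> * t)) * indicator {t. 0 \<le> t \<and> \<tau> \<omega> \<le> ennreal t} t *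
       h (X (max 0 t) \<omega>) \<partial>lborel)"
    proof (cases "\<tau> \<omega>")
      case top
      then show ?thesis by (simp add: discount_def top_unique)
    next
      case (real r)
      let ?k = "\<lambda>t. ennreal (exp (- \<alpha> * t)) * indicator {r..} t * h (X (max 0 t) \<omega>)"
      have "(\<integral>\<^sup>+ t. ennreal (exp (- \<alpha> * t)) * indicator {t. 0 \<le> t \<and> \<tau> \<omega> \<le> ennreal t} t *
         h (X (max 0 t) \<omega>) \<partial>lborel) = (\<integral>\<^sup>+ t. ?k t \<partial>lborel)"
        using real by (intro nn_integral_cong) (auto split: split_indicator)
      \<comment> \<open>The substitution \<open>t = \<tau> + s\<close>.\<close>
      also have "\<dots> = (\<integral>\<^sup>+ s. ?k (r + s) \<partial>lborel)"
        using nn_integral_real_affine[of ?k 1 r] by simp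
      also have "\<dots> = (\<integral>\<^sup>+ s. ?e s * (?d \<omega> * h (X (enn2real (\<tau> \<omega>) + max 0 s) \<omega>)) \<partial>lborel)"
      proof (rule nn_integral_cong)
        fix s :: real
        have "ennreal (exp (- \<alpha> * (r + s))) = ennreal (exp (- \<alpha> * s)) * ennreal (exp (- \<alpha> * r))"
          by (simp add: algebra_simps flip: ennreal_mult exp_add)
        then show "?k (r + s) = ?e s * (?d \<omega> * h (X (enn2real (\<tau> \<omega>) + max 0 s) \<omega>))"
          using real by (auto simp: discount_def max_def mult.assoc split: split_indicator)
      qed
      finally show ?thesis ..
    qed
  qed
  finally show ?thesis .
qed

section \<open>Entrance times under positive jumps\<close>

lemma X_adapted: "0 \<le> t \<Longrightarrow> X t \<in> borel_measurable (F t)"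
  using measurable_compose[OF measurable_Pair1' progressive[of t], of t]
  by (simp add: space_restrict_space)

lemma first_entry_open_stopping_time:
  assumes "open U"
  shows "is_stopping_time M F (first_entry X U)"
proof (rule is_stopping_timeI_less)
  fix t :: real assume t: "0 \<le> t"
  let ?Q = "{q \<in> \<rat>. 0 \<le> q \<and> q < t}"
  have "countable ?Q" using countable_rat by (rule countable_subset[rotated]) auto
  moreover have "{\<omega> \<in> space M. X q \<omega> \<in> U} \<in> sets (F t)" if "q \<in> ?Q" for q
  proof -
    have "X q -` U \<inter> space (F q) \<in> sets (F q)"
      using that assms by (intro measurable_sets[OF X_adapted]) auto
    moreover have "X q -` U \<inter> space (F q) = {\<omega> \<in> space M. X q \<omega> \<in> U}"
      using that by (auto simp: space_F)
    ultimately show ?thesis using that mono_F[of q t] by auto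
  qed
  ultimately have "(\<Union>q\<in>?Q. {\<omega> \<in> space M. X q \<omega> \<in> U}) \<in> sets (F t)"
    by (intro sets.countable_UN') auto
  also have "(\<Union>q\<in>?Q. {\<omega> \<in> space M. X q \<omega> \<in> U}) = {\<omega> \<in> space M. first_entry X U \<omega> < ennreal t}"
  proof safe
    fix \<omega> q assume "X q \<omega> \<in> U" "0 \<le> q" "q < t"
    then show "first_entry X U \<omega> < ennreal t"
      unfolding first_entry_less_iff by (auto simp: ennreal_less_iff)
  next
    fix \<omega> assume \<omega>: "\<omega> \<in> space M" "first_entry X U \<omega> < ennreal t"
    then obtain s where s: "0 \<le> s" "X s \<omega> \<in> U" "s < t"
      unfolding first_entry_less_iff by (auto simp: ennreal_less_iff)
    have "\<forall>\<^sub>F u in at_right s. X u \<omega> \<in> U"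
      using right_continuous_paths[OF \<omega>(1) s(1)] assms s(2) by (rule topological_tendstoD)
    then obtain b where b: "s < b" "\<And>u. s < u \<Longrightarrow> u < b \<Longrightarrow> X u \<omega> \<in> U"
      unfolding eventually_at_right_field by blast
    obtain q where "q \<in> \<rat>" "s < q" "q < min b t"
      using Rats_dense_in_real[of s "min b t"] b(1) s(3) by auto
    then show "\<omega> \<in> (\<Union>q\<in>?Q. {\<omega> \<in> space M. X q \<omega> \<in> U})"
      using s(1) b(2) \<omega>(1) by (auto intro!: bexI[of _ q])
  qed
  finally show "{\<omega> \<in> space M. first_entry X U \<omega> < ennreal t} \<in> sets (F t)" .
qed

lemma stopping_time_SUP:
  assumes "\<And>n::nat. is_stopping_time M F (T n)"
  shows "is_stopping_time M F (\<lambda>\<omega>. SUP n. T n \<omega>)"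
proof (rule is_stopping_timeI)
  fix t :: real assume t: "0 \<le> t"
  have "(\<Inter>n. {\<omega> \<in> space M. T n \<omega> \<le> ennreal t}) \<in> sets (F t)"
    using stopping_time_le[OF assms t] by (intro sets.countable_INT) auto
  also have "(\<Inter>n. {\<omega> \<in> space M. T n \<omega> \<le> ennreal t}) = {\<omega> \<in> space M. (SUP n. T n \<omega>) \<le> ennreal t}"
    by (auto simp: SUP_le_iff)
  finally show "{\<omega> \<in> space M. (SUP n. T n \<omega>) \<le> ennreal t} \<in> sets (F t)" .
qed

lemma X_first_entry_in_closure:
  assumes \<omega>: "\<omega> \<in> space M" and r: "first_entry X A \<omega> = ennreal r" "0 \<le> r"
  shows "X r \<omega> \<in> closure A"
proof (rule ccontr)
  assume neg: "X r \<omega> \<notin> closure A"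
  then have "\<forall>\<^sub>F u in at_right r. X u \<omega> \<in> - closure A"
    using right_continuous_paths[OF \<omega> r(2)] by (intro topological_tendstoD) auto
  then obtain b where b: "r < b" "\<And>u. r < u \<Longrightarrow> u < b \<Longrightarrow> X u \<omega> \<notin> closure A"
    unfolding eventually_at_right_field by auto
  have "first_entry X A \<omega> < ennreal b" using b(1) r by (simp add: ennreal_less_iff)
  then obtain t where t: "0 \<le> t" "X t \<omega> \<in> A" "t < b"
    unfolding first_entry_less_iff by (auto simp: ennreal_less_iff)
  have "r \<le> t" using first_entry_le[of t X \<omega> A] t r by simp
  moreover have "X t \<omega> \<in> closure A" using t(2) closure_subset by auto
  ultimately show False using b(2)[of t] neg t(3) by (cases "t = r") auto
qed

text \<open>
  The entry times into decreasing sets \<open>A\<^sub>n\<close> increase to their supremum \<open>r\<close>. If they reach \<open>r\<close> after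
  finitely many steps, then \<open>X\<^sub>r\<close> is adherent to every \<open>A\<^sub>n\<close>; if they stay below \<open>r\<close>, then the left
  limit at \<open>r\<close> is.
\<close>

lemma SUP_first_entry_cases:
  assumes \<omega>: "\<omega> \<in> space M" and A: "decseq A"
    and r: "(SUP n. first_entry X (A n) \<omega>) = ennreal r" "0 \<le> r"
  obtains "\<And>n. X r \<omega> \<in> closure (A n)"
    | l where "0 < r" "((\<lambda>s. X s \<omega>) \<longlongrightarrow> l) (at_left r)" "\<And>n. l \<in> closure (A n)"
proof -
  define u where "u n = enn2real (first_entry X (A n) \<omega>)" for n
  have le: "first_entry X (A n) \<omega> \<le> ennreal r" for n
    unfolding r(1)[symmetric] by (rule SUP_upper) simp
  have eq: "first_entry X (A n) \<omega> = ennreal (u n)" for n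
    using order_le_less_trans[OF le[of n] ennreal_less_top] by (simp add: u_def)
  have u: "0 \<le> u n" "u n \<le> r" for n
    using le[of n] r(2) unfolding eq by (auto simp: u_def)
  have inc: "incseq (\<lambda>n. first_entry X (A n) \<omega>)"
    using A by (auto simp: incseq_def decseq_def intro: first_entry_antimono)
  have "(\<lambda>n. first_entry X (A n) \<omega>) \<longlonglongrightarrow> ennreal r"
    unfolding r(1)[symmetric] using inc by (rule LIMSEQ_SUP)
  then have lim: "u \<longlonglongrightarrow> r"
    using u r(2) unfolding eq by (intro tendsto_ennrealD) auto
  have incu: "u i \<le> u j" if "i \<le> j" for i j
    using incseqD[OF inc that] u unfolding eq by simp
  have cl: "X (u n) \<omega> \<in> closure (A n)" for n
    using \<omega> eq u(1) by (rule X_first_entry_in_closure)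
  have mono: "closure (A j) \<subseteq> closure (A i)" if "i \<le> j" for i j
    using A that by (intro closure_mono) (auto simp: decseq_def)
  show ?thesis
  proof (cases "\<exists>n. u n = r")
    case True
    then obtain n where n: "u n = r" ..
    have "X r \<omega> \<in> closure (A k)" for k
    proof -
      have "u (max n k) = r" using incu[of n "max n k"] u(2)[of "max n k"] n by simp
      then show ?thesis using cl[of "max n k"] mono[of k "max n k"] by auto
    qed
    then show ?thesis by (rule that(1))
  next
    case False
    then have less: "u n < r" for n using u(2)[of n] by (auto simp: less_le)
    have "0 < r" using u(1)[of 0] less[of 0] by simp
    then obtain l where l: "((\<lambda>s. X s \<omega>) \<longlongrightarrow> l) (at_left r)" using left_limits[OF \<omega>] by blast
    have "filterlim u (at_left r) sequentially"
      using lim less by (auto simp: filterlim_at intro!: always_eventually less_imp_neq)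
    from filterlim_compose[OF l this] have X: "(\<lambda>n. X (u n) \<omega>) \<longlonglongrightarrow> l" .
    have "l \<in> closure (A k)" for k
    proof (rule Lim_in_closed_set[OF _ _ _ X])
      show "\<forall>\<^sub>F n in sequentially. X (u n) \<omega> \<in> closure (A k)"
        using cl mono by (intro eventually_sequentiallyI[of k]) blast
    qed auto
    with \<open>0 < r\<close> l show ?thesis by (rule that(2))
  qed
qed

lemma left_limit_le:
  assumes "positive_jumps M X" "\<omega> \<in> space M" "0 < t" "((\<lambda>s. X s \<omega>) \<longlongrightarrow> l) (at_left t)"
  shows "l \<le> X t \<omega>"
  using assms tendsto_Lim[OF trivial_limit_at_left_real assms(4)]
  by (fastforce simp: positive_jumps_def jump_def)

text \<open>
  In both cases of \<open>SUP_first_entry_cases\<close> one has \<open>X\<^sub>r \<ge> b\<close>, because \<open>X\<^sub>r\<close> is at least the left limit.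
  The identity holds on every path, not just almost surely, so the entrance time inherits the
  stopping time property from the supremum.
\<close>

lemma X_entrance_time:
  assumes "positive_jumps M X" "\<omega> \<in> space M"
  shows "entrance_time X b \<omega> = (SUP n. first_entry X {b - 1 / real (Suc n)<..} \<omega>)" (is "?e = ?s")
    and "entrance_time X b \<omega> < \<infinity> \<Longrightarrow> b \<le> at_time X (entrance_time X b) \<omega>"
proof -
  let ?A = "\<lambda>n. {b - 1 / real (Suc n)<..}"
  have e: "?e = first_entry X {b..} \<omega>" by (simp add: entrance_time_def first_entry_def)
  have dec: "decseq ?A" by (auto simp: decseq_def frac_le intro: order_le_less_trans[rotated])
  have le: "?s \<le> ?e"
    unfolding e by (intro SUP_least first_entry_antimono) (auto intro: less_le_trans[rotated])
  have cl: "b \<le> l" if "\<And>n. l \<in> closure (?A n)" for l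
  proof (rule field_le_epsilon)
    fix e :: real assume "0 < e"
    then obtain n where "1 / real (Suc n) < e" using nat_approx_posE by blast
    with that[of n] show "b \<le> l + e" by simp
  qed
  have above: "b \<le> X r \<omega>" if r: "?s = ennreal r" "0 \<le> r" for r
    using assms(2) dec r
    by (rule SUP_first_entry_cases) (use cl left_limit_le[OF assms] in \<open>fastforce+\<close>)
  show eq: "?e = ?s"
  proof (cases "?s")
    case (real r)
    then show ?thesis using le above[of r] first_entry_le[of r X \<omega> "{b..}"] by (simp add: e)
  next
    case top
    with le show ?thesis using top.extremum_uniqueI by metis
  qed
  assume "?e < \<infinity>"
  then show "b \<le> at_time X (entrance_time X b) \<omega>"
    using above[of "enn2real ?e"] unfolding at_time_def by (simp add: eq less_top)
qed

lemma entrance_time_stopping_time: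
  assumes "positive_jumps M X"
  shows "is_stopping_time M F (entrance_time X b)"
proof -
  let ?T = "\<lambda>\<omega>. SUP n. first_entry X {b - 1 / real (Suc n)<..} \<omega>"
  have "is_stopping_time M F ?T"
    by (intro stopping_time_SUP first_entry_open_stopping_time) auto
  moreover have "is_stopping_time M F (entrance_time X b) = is_stopping_time M F ?T"
    unfolding is_stopping_time_def
    using X_entrance_time(1)[OF assms] by (simp cong: measurable_cong conj_cong)
  ultimately show ?thesis by blast
qed

text \<open>
  The process started at \<open>x \<ge> b\<close> stays above \<open>b\<close> before \<open>T\<close> and is almost surely equal to \<open>b\<close> at
  \<open>T\<close>: left-quasi-continuity gives \<open>X\<^sub>T \<le> b\<close>, and \<open>X\<^sub>T \<ge> b\<close> because the left limit at \<open>T\<close> is at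
  least \<open>b\<close> and the jump is nonnegative (or, if \<open>T = 0\<close>, because \<open>X\<^sub>0 = x\<close>).
\<close>

lemma down_crossing:
  fixes b x :: real
  assumes "positive_jumps M X" "b \<le> x"
  defines "T \<equiv> \<lambda>\<omega>. SUP n. first_entry X {..<b + 1 / real (Suc n)} \<omega>"
  shows "is_stopping_time M F T"
    and "0 \<le> t \<Longrightarrow> ennreal t < T \<omega> \<Longrightarrow> b < X t \<omega>"
    and "AE \<omega> in P x. T \<omega> < \<infinity> \<longrightarrow> at_time X T \<omega> = b"
proof -
  let ?A = "\<lambda>n. {..<b + 1 / real (Suc n)}"
  have S: "is_stopping_time M F (first_entry X (?A n))" for n
    by (intro first_entry_open_stopping_time) auto
  show "is_stopping_time M F T"
    unfolding T_def using S by (intro stopping_time_SUP)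
  show before: "b < X t \<omega>" if t: "0 \<le> t" "ennreal t < T \<omega>" for t \<omega>
  proof -
    obtain n where "ennreal t < first_entry X (?A n) \<omega>"
      using t(2) unfolding T_def less_SUP_iff by auto
    then have "\<not> X t \<omega> < b + 1 / real (Suc n)"
      using first_entry_le[of t X \<omega> "?A n"] t(1) by auto
    then show ?thesis by (auto simp: not_less intro: less_le_trans[rotated])
  qed
  have inc: "incseq (\<lambda>n. first_entry X (?A n) \<omega>)" for \<omega>
    by (intro incseq_SucI first_entry_antimono) (auto simp: frac_le intro: less_le_trans)
  have "AE \<omega> in P x. T \<omega> < \<infinity> \<longrightarrow> (\<lambda>n. at_time X (first_entry X (?A n)) \<omega>) \<longlonglongrightarrow> at_time X T \<omega>"
    using S inc LIMSEQ_SUP[OF inc] unfolding T_def by (intro left_quasi_continuous) auto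
  with start[of x] AE_space[of "P x"]
  show "AE \<omega> in P x. T \<omega> < \<infinity> \<longrightarrow> at_time X T \<omega> = b"
  proof eventually_elim
    case (elim \<omega>)
    show ?case
    proof
      assume fin: "T \<omega> < \<infinity>"
      define r where "r = enn2real (T \<omega>)"
      have r: "T \<omega> = ennreal r" "0 \<le> r" using fin by (auto simp: r_def less_top)
      have "at_time X (first_entry X (?A n)) \<omega> \<le> b + 1 / real (Suc n)" for n
      proof -
        have "first_entry X (?A n) \<omega> \<le> T \<omega>" unfolding T_def by (rule SUP_upper) simp
        then have "first_entry X (?A n) \<omega> < \<top>" using fin by (simp add: order_le_less_trans)
        then have "X (enn2real (first_entry X (?A n) \<omega>)) \<omega> \<in> closure (?A n)"
          using elim(2) by (intro X_first_entry_in_closure) (auto simp: space_P)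
        then show ?thesis by (simp add: at_time_def)
      qed
      moreover have "(\<lambda>n. b + 1 / real (Suc n)) \<longlonglongrightarrow> b"
        using LIMSEQ_inverse_real_of_nat_add[of b] by (simp add: inverse_eq_divide)
      ultimately have "at_time X T \<omega> \<le> b"
        using elim(3) fin by (intro LIMSEQ_le) auto
      moreover have "b \<le> at_time X T \<omega>"
      proof (cases "r = 0")
        case True
        then show ?thesis using elim(1) assms(2) by (simp add: at_time_def flip: r_def)
      next
        case False
        with r have pos: "0 < r" by simp
        have \<omega>: "\<omega> \<in> space M" using elim(2) by (simp add: space_P)
        obtain l where l: "((\<lambda>s. X s \<omega>) \<longlongrightarrow> l) (at_left r)" using left_limits[OF \<omega> pos] by blast
        have "\<forall>\<^sub>F s in at_left r. b \<le> X s \<omega>"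
          using eventually_at_left_real[OF pos]
          by eventually_elim (auto intro!: less_imp_le before simp: r ennreal_less_iff)
        then have "b \<le> l"
          using l by (intro tendsto_lowerbound[OF l]) auto
        also have "l \<le> X r \<omega>" using assms(1) \<omega> pos l by (rule left_limit_le)
        finally show ?thesis by (simp add: at_time_def flip: r_def)
      qed
      ultimately show "at_time X T \<omega> = b" by simp
    qed
  qed
qed

section \<open>Potentials along stopping times\<close>

lemma green_kernel_excessive:
  assumes "is_stopping_time M F \<tau>" and "0 < \<alpha>" and "h \<in> borel_measurable borel"
  shows "(\<integral>\<^sup>+ \<omega>. ennreal (discount \<alpha> \<tau> \<omega>) * (\<integral>\<^sup>+ y. h y \<partial>green_kernel P X \<alpha> (at_time X \<tau> \<omega>)) \<partial>P x)
    \<le> (\<integral>\<^sup>+ y. h y \<partial>green_kernel P X \<alpha> x)"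
  unfolding discounted_green_kernel_at_stopping_time[OF assms]
  unfolding nn_integral_green_kernel_paths[OF assms(3), of \<alpha> x]
proof (intro nn_integral_mono mult_right_mono mult_left_mono)
  show "indicator {t. 0 \<le> t \<and> \<tau> \<omega> \<le> ennreal t} t \<le> (indicator {0..} t :: ennreal)" for \<omega> and t :: real
    by (simp add: indicator_def)
qed simp_all

lemma green_kernel_harmonic_before:
  assumes \<tau>: "is_stopping_time M F \<tau>" and "0 < \<alpha>" and h: "h \<in> borel_measurable borel"
    and zero: "\<And>\<omega> t. \<omega> \<in> space M \<Longrightarrow> 0 \<le> t \<Longrightarrow> ennreal t < \<tau> \<omega> \<Longrightarrow> h (X t \<omega>) = 0"
  shows "(\<integral>\<^sup>+ \<omega>. ennreal (discount \<alpha> \<tau> \<omega>) * (\<integral>\<^sup>+ y. h y \<partial>green_kernel P X \<alpha> (at_time X \<tau> \<omega>)) \<partial>P x)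
    = (\<integral>\<^sup>+ y. h y \<partial>green_kernel P X \<alpha> x)"
  unfolding discounted_green_kernel_at_stopping_time[OF assms(1-3)]
  unfolding nn_integral_green_kernel_paths[OF h]
proof (intro nn_integral_cong)
  fix \<omega> and t :: real assume "\<omega> \<in> space (P x)"
  then have "h (X t \<omega>) = 0" if "0 \<le> t" "\<not> \<tau> \<omega> \<le> ennreal t"
    using that by (intro zero) (simp_all add: space_P not_le)
  then show "ennreal (exp (- \<alpha> * t)) * indicator {t. 0 \<le> t \<and> \<tau> \<omega> \<le> ennreal t} t * h (X (max 0 t) \<omega>) =
      ennreal (exp (- \<alpha> * t)) * indicator {0..} t * h (X (max 0 t) \<omega>)"
    by (cases "0 \<le> t"; cases "\<tau> \<omega> \<le> ennreal t") (simp_all add: max_absorb2)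
qed

text \<open>
  The constant is \<open>c = E\<^sub>x (e\<^bsup>-\<alpha>T\<^esup>)\<close> for the crossing time \<open>T\<close> of \<open>down_crossing\<close>; it does not
  depend on \<open>h\<close>, so the positive and negative parts of \<open>f\<close> can be treated separately.
\<close>

lemma green_kernel_below_level:
  assumes "positive_jumps M X" "0 < \<alpha>" "b \<le> x"
  obtains c where "\<And>h. h \<in> borel_measurable borel \<Longrightarrow> (\<And>z. b < z \<Longrightarrow> h z = 0) \<Longrightarrow>
    (\<integral>\<^sup>+ y. h y \<partial>green_kernel P X \<alpha> x) = c * (\<integral>\<^sup>+ y. h y \<partial>green_kernel P X \<alpha> b)"
proof -
  obtain T where T: "is_stopping_time M F T"
      "\<And>t \<omega>. 0 \<le> t \<Longrightarrow> ennreal t < T \<omega> \<Longrightarrow> b < X t \<omega>"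
      "AE \<omega> in P x. T \<omega> < \<infinity> \<longrightarrow> at_time X T \<omega> = b"
    using down_crossing[OF assms(1,3)] by blast
  note [measurable] = stopping_time_measurable[OF T(1)]
  have "(\<integral>\<^sup>+ y. h y \<partial>green_kernel P X \<alpha> x) =
      (\<integral>\<^sup>+ \<omega>. ennreal (discount \<alpha> T \<omega>) \<partial>P x) * (\<integral>\<^sup>+ y. h y \<partial>green_kernel P X \<alpha> b)"
    if h: "h \<in> borel_measurable borel" "\<And>z. b < z \<Longrightarrow> h z = 0" for h
  proof -
    have "(\<integral>\<^sup>+ y. h y \<partial>green_kernel P X \<alpha> x) =
        (\<integral>\<^sup>+ \<omega>. ennreal (discount \<alpha> T \<omega>) * (\<integral>\<^sup>+ y. h y \<partial>green_kernel P X \<alpha> (at_time X T \<omega>)) \<partial>P x)"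
      using T(1) assms(2) h T(2) by (intro green_kernel_harmonic_before[symmetric]) blast+
    also have "\<dots> = (\<integral>\<^sup>+ \<omega>. ennreal (discount \<alpha> T \<omega>) * (\<integral>\<^sup>+ y. h y \<partial>green_kernel P X \<alpha> b) \<partial>P x)"
    proof (rule nn_integral_cong_AE)
      show "AE \<omega> in P x. ennreal (discount \<alpha> T \<omega>) * (\<integral>\<^sup>+ y. h y \<partial>green_kernel P X \<alpha> (at_time X T \<omega>)) =
          ennreal (discount \<alpha> T \<omega>) * (\<integral>\<^sup>+ y. h y \<partial>green_kernel P X \<alpha> b)"
        using T(3)
      proof eventually_elim
        case (elim \<omega>)
        then show ?case by (cases "T \<omega> = \<infinity>") (simp_all add: discount_def less_top)
      qed
    qed
    also have "\<dots> = (\<integral>\<^sup>+ \<omega>. ennreal (discount \<alpha> T \<omega>) \<partial>P x) * (\<integral>\<^sup>+ y. h y \<partial>green_kernel P X \<alpha> b)"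
      by (rule nn_integral_multc) measurable
    finally show ?thesis .
  qed
  then show ?thesis by (rule that)
qed

lemma set_integral_below_level:
  assumes "positive_jumps M X" "0 < \<alpha>" "b \<le> x"
    and f: "\<And>y. integrable (green_kernel P X \<alpha> y) (f :: real \<Rightarrow> real)"
    and zero: "(LINT y:{..<b}|green_kernel P X \<alpha> b. f y) = 0"
  shows "(LINT y:{..<b}|green_kernel P X \<alpha> x. f y) = 0"
proof -
  let ?G = "green_kernel P X \<alpha>"
  let ?k = "\<lambda>y. indicator {..<b} y * f y"
  have [measurable]: "f \<in> borel_measurable borel"
    using borel_measurable_integrable[OF f] measurable_cong_sets[OF sets_green_kernel refl] by blast
  have eq: "(LINT y:{..<b}|?G z. f y) =
      enn2real (\<integral>\<^sup>+ y. ennreal (?k y) \<partial>?G z) - enn2real (\<integral>\<^sup>+ y. ennreal (- ?k y) \<partial>?G z)" for z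
    unfolding set_lebesgue_integral_def real_scaleR_def
    using integrable_mult_indicator[OF _ f, of "{..<b}" z]
    by (intro real_lebesgue_integral_def) simp
  obtain c where c: "\<And>h. h \<in> borel_measurable borel \<Longrightarrow> (\<And>z. b < z \<Longrightarrow> h z = 0) \<Longrightarrow>
      (\<integral>\<^sup>+ y. h y \<partial>?G x) = c * (\<integral>\<^sup>+ y. h y \<partial>?G b)"
    using green_kernel_below_level[OF assms(1-3)] by blast
  have "(LINT y:{..<b}|?G x. f y) = enn2real c * (LINT y:{..<b}|?G b. f y)"
    unfolding eq by (subst (1 2) c) (simp_all add: enn2real_mult right_diff_distrib)
  with zero show ?thesis by simp
qed

end

section \<open>Optimality of the entrance time\<close>

theorem theorem2p2:
  fixes M :: "'a measure"
    and F P :: "real \<Rightarrow> 'a measure"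
    and X :: "real \<Rightarrow> 'a \<Rightarrow> real"
    and \<alpha> xs :: real
    and g f gt V :: "real \<Rightarrow> real"
    and \<tau>s :: "'a \<Rightarrow> ennreal"
  assumes "standard_markov_process M F P X"
    and "positive_jumps M X"
    and "\<alpha> > 0"
    and "continuous_on UNIV g"
    and "\<And>x. g x \<ge> 0"
    and "f \<in> borel_measurable borel"
    and "gt \<in> borel_measurable borel"
    and "\<And>x. integrable (green_kernel P X \<alpha> x) f"
    and "\<And>x. gt x = (LINT y|green_kernel P X \<alpha> x. f y)"
    and "gt xs = (LINT y:{xs..}|green_kernel P X \<alpha> xs. f y)"
    and "\<And>x. x \<ge> xs \<Longrightarrow> f x \<ge> 0"
    and "\<And>x. x \<le> xs \<Longrightarrow> (LINT y:{xs..}|green_kernel P X \<alpha> x. f y) \<ge> g x"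
    and "\<And>x. x \<ge> xs \<Longrightarrow> g x = gt x"
    and "\<And>\<omega>. \<tau>s \<omega> = entrance_time X xs \<omega>"
    and "\<And>x. V x = (LINT y:{xs..}|green_kernel P X \<alpha> x. f y)"
  shows "is_stopping_time M F \<tau>s \<and>
    (\<forall>x. ereal (V x) = (SUP \<tau>\<in>{\<tau>. is_stopping_time M F \<tau>}. expected_reward P X \<alpha> g x \<tau>) \<and>
         (SUP \<tau>\<in>{\<tau>. is_stopping_time M F \<tau>}. expected_reward P X \<alpha> g x \<tau>)
           = expected_reward P X \<alpha> g x \<tau>s)"
proof -
  interpret standard_markov_process M F P X by fact
  let ?G = "green_kernel P X \<alpha>"
  note jumps = assms(2) and \<alpha> = assms(3) and f = assms(8)
  note [measurable] = assms(6)
  have [measurable]: "g \<in> borel_measurable borel"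
    using assms(4) by (rule borel_measurable_continuous_onI)
  have set_int: "set_integrable (?G x) A f" if "A \<in> sets borel" for A x
    unfolding set_integrable_def using f that by (intro integrable_mult_indicator) auto
  have split: "gt x = (LINT y:{..<xs}|?G x. f y) + V x" for x
  proof -
    have "gt x = (LINT y:UNIV|?G x. f y)"
      by (simp add: assms(9) set_lebesgue_integral_def)
    also have "UNIV = {..<xs} \<union> {xs..}" by auto
    also have "(LINT y:{..<xs} \<union> {xs..}|?G x. f y) = (LINT y:{..<xs}|?G x. f y) + V x"
      unfolding assms(15) using set_int by (intro set_integral_Un) auto
    finally show ?thesis .
  qed
  \<comment> \<open>On \<open>[xs, \<infinity>)\<close> the part of \<open>f\<close> below \<open>xs\<close> does not contribute to the potential.\<close>
  have V_eq: "V x = g x" if "xs \<le> x" for x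
  proof -
    have "(LINT y:{..<xs}|?G xs. f y) = 0"
      using split[of xs] assms(10,15) by simp
    from set_integral_below_level[OF jumps \<alpha> that f this]
    show ?thesis using split[of x] assms(13)[OF that] by simp
  qed
  have V_ge: "g x \<le> V x" for x
    using V_eq[of x] assms(12)[of x] assms(15) by (cases "xs \<le> x") auto
  have V_nonneg: "0 \<le> V x" for x using V_ge assms(5) order_trans by blast
  define h where "h z = ennreal (indicator {xs..} z * f z)" for z
  have [measurable]: "h \<in> borel_measurable borel" unfolding h_def by measurable
  have Uh: "(\<integral>\<^sup>+ y. h y \<partial>?G x) = ennreal (V x)" for x
    unfolding h_def assms(15) set_lebesgue_integral_def real_scaleR_def
    using set_int[of "{xs..}" x] assms(11)
    by (intro nn_integral_eq_integral) (auto simp: set_integrable_def split: split_indicator)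
  have \<tau>s: "\<tau>s = entrance_time X xs" using assms(14) by auto
  have stop: "is_stopping_time M F \<tau>s"
    unfolding \<tau>s using jumps by (rule entrance_time_stopping_time)
  have reward: "ennreal (discounted_reward X \<alpha> g \<tau> \<omega>) = ennreal (discount \<alpha> \<tau> \<omega>) * ennreal (g (at_time X \<tau> \<omega>))"
    for \<tau> \<omega>
    by (simp add: discounted_reward_def discount_def assms(5) flip: ennreal_mult)
  have upper: "expected_reward P X \<alpha> g x \<tau> \<le> ereal (V x)" if "is_stopping_time M F \<tau>" for x \<tau>
  proof -
    have "(\<integral>\<^sup>+ \<omega>. ennreal (discounted_reward X \<alpha> g \<tau> \<omega>) \<partial>P x) \<le>
        (\<integral>\<^sup>+ \<omega>. ennreal (discount \<alpha> \<tau> \<omega>) * (\<integral>\<^sup>+ y. h y \<partial>?G (at_time X \<tau> \<omega>)) \<partial>P x)"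
      unfolding reward Uh by (intro nn_integral_mono mult_left_mono ennreal_leI V_ge) auto
    also have "\<dots> \<le> ennreal (V x)"
      unfolding Uh[of x, symmetric] using that \<alpha> by (intro green_kernel_excessive) auto
    finally have "enn2ereal (\<integral>\<^sup>+ \<omega>. ennreal (discounted_reward X \<alpha> g \<tau> \<omega>) \<partial>P x) \<le> enn2ereal (ennreal (V x))"
      by (simp only: less_eq_ennreal.rep_eq)
    then show ?thesis
      by (simp add: expected_reward_def enn2ereal_ennreal V_nonneg)
  qed
  have attained: "expected_reward P X \<alpha> g x \<tau>s = ereal (V x)" for x
  proof -
    have "(\<integral>\<^sup>+ \<omega>. ennreal (discounted_reward X \<alpha> g \<tau>s \<omega>) \<partial>P x) =
        (\<integral>\<^sup>+ \<omega>. ennreal (discount \<alpha> \<tau>s \<omega>) * (\<integral>\<^sup>+ y. h y \<partial>?G (at_time X \<tau>s \<omega>)) \<partial>P x)"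
    proof (rule nn_integral_cong)
      fix \<omega> assume "\<omega> \<in> space (P x)"
      then have "\<tau>s \<omega> < \<infinity> \<Longrightarrow> xs \<le> at_time X \<tau>s \<omega>"
        unfolding \<tau>s using X_entrance_time(2)[OF jumps] by (simp add: space_P)
      then show "ennreal (discounted_reward X \<alpha> g \<tau>s \<omega>) =
          ennreal (discount \<alpha> \<tau>s \<omega>) * (\<integral>\<^sup>+ y. h y \<partial>?G (at_time X \<tau>s \<omega>))"
        unfolding reward Uh using V_eq by (cases "\<tau>s \<omega> = \<infinity>") (auto simp: discount_def less_top)
    qed
    also have "\<dots> = ennreal (V x)"
      unfolding Uh[of x, symmetric]
    proof (rule green_kernel_harmonic_before[OF stop \<alpha>])
      fix \<omega> t assume "0 \<le> t" "ennreal t < \<tau>s \<omega>"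
      then have "X t \<omega> < xs"
        using first_entry_le[of t X \<omega> "{xs..}"]
        by (force simp: \<tau>s entrance_time_def first_entry_def not_less[symmetric])
      then show "h (X t \<omega>) = 0" by (simp add: h_def)
    qed measurable
    finally show ?thesis
      unfolding expected_reward_def using V_nonneg[of x] by (simp add: enn2ereal_ennreal)
  qed
  have "(SUP \<tau>\<in>{\<tau>. is_stopping_time M F \<tau>}. expected_reward P X \<alpha> g x \<tau>) = ereal (V x)" for x
  proof (rule antisym)
    show "(SUP \<tau>\<in>{\<tau>. is_stopping_time M F \<tau>}. expected_reward P X \<alpha> g x \<tau>) \<le> ereal (V x)"
      using upper by (intro SUP_least) auto
    show "ereal (V x) \<le> (SUP \<tau>\<in>{\<tau>. is_stopping_time M F \<tau>}. expected_reward P X \<alpha> g x \<tau>)"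
      unfolding attained[symmetric] using stop by (intro SUP_upper) auto
  qed
  with stop attained show ?thesis by simp
qed

end
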